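(* Consider the optimal control problem of $N$ agents $$\min_u\ \int_0^T\Big[J(u,m(\vec x))+\tfrac\alpha2u^2\Big]dt\quad\text{s.t.}\quad \dot x_i=\frac1N\sum_{j=1}^NG(x_i,x_j,u),\quad x_i(0)=x_{i,0},\quad i=1,\dots,N, \tag{A}$$ with one common control $u=u(t)$, and the optimal control problem $$\min_u\ \int_0^T\Big[J(u,m_{h^{\mathrm{MO}}}(t))+\tfrac\alpha2u^2\Big]dt\quad\text{s.t.}\quad 0=\partial_th^{\mathrm{MO}}+\mathrm{div}_x\Big(h^{\mathrm{MO}}\int G(x,\hat x,u)h^{\mathrm{MO}}(t,\hat x)\,d\hat x\Big),\quad h^{\mathrm{MO}}(0,x)=h^{\mathrm{MO}}_0(x), \tag{B}$$ for the density $h^{\mathrm{MO}}:[0,T]\times\mathbb R^n\to\mathbb R$ of agents. Let $h^{\mathrm{OM}}:[0,T]\times\mathbb R^n\times\mathbb R^n\to\mathbb R$, $h^{\mathrm{OM}}=h^{\mathrm{OM}}(t,x,\lambda)$, be the distribution function which satisfies the mean-field limit of the first-order optimality conditions of problem (A). Let $\Lambda=\Lambda(t,x)$ be the multiplier in the optimality system of (B). Then the solution of the mean-field limit of the optimality conditions of (A) and the solution of the optimality conditions of (B) are formally identified by $$\nabla_x\Lambda(t,x)=-\int\lambda\,h^{\mathrm{OM}}_2(t,x,\lambda)\,d\lambda$$ for all $t\ge0$ and all $x$ in the support of $h^{\mathrm{MO}}$, where the function $h^{\mathrm{OM}}_2$ is given by $$h^{\mathrm{OM}}(t,x,\lamb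da)=h^{\mathrm{MO}}(t,x)\,h^{\mathrm{OM}}_2(t,x,\lambda).$$
   Context: **Data.** $x_i=x_i(t)\in\mathbb R^n$, $\vec x=(x_i)_{i=1}^N$, $u=u(t)\in\mathbb R^{n_u}$, $\alpha>0$; $G:\mathbb R^n\times\mathbb R^n\times\mathbb R^{n_u}\to\mathbb R^n$ and $J:\mathbb R^{n_u}\times\mathbb R^n\to\mathbb R$ are differentiable; $m(\vec x)=\frac1N\sum_i\tilde m(x_i)$ with $\tilde m:\mathbb R^n\to\mathbb R^n$; $m_{h}(t)=\int\tilde m(x)\,h$ (integral over all non-time variables of $h$). $u^2$ means $|u|^2$. The agents are assumed identically independent and the interaction $G$ symmetric, in the sense that the mean-field limit of (A) is (B). $h_2^{\mathrm{OM}}$ is the conditional density, $\int h^{\mathrm{OM}}_2(t,x,\lambda)\,d\lambda=1$. $D_1,D_2,D_u$ are Jacobians in the first, second and third argument of $G$; a hat denotes evaluation at hatted variables. **Formal setting.** All functions are assumed regular and decaying enough for differentiation and integration by parts; derivatives with respect to densities are $L^2$ (Gateaux) derivatives; the adjoint equation for $\Lambda$ is compared after applying $\nabla_x$ (additive functions of $t$ are irrelevant). "Formally identified" means that, under the stated relations and with the same control $u$, the two systems below coincide. **Mean-field limit of the optimality conditions of (A).** The first-order conditions of (A), with multipliers $\lambda_i\in\mathbb R^n$ (scaled by $N$), are the state equations, $\dot\lambda_i=-D\tilde m(x_i)^\top\nabla_mJ(u,m(\vec x))-\frac1N\sum_j[D_1G(x_i,x_j,u)^\top\lambda_i+D_2G(x_j,x_i,u)^\top\lambda_j]$,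 $\lambda_i(T)=0$, and $0=\nabla_uJ(u,m(\vec x))+\alpha u+\frac1{N^2}\sum_{i,j}D_uG(x_i,x_j,u)^\top\lambda_i$. Their mean-field limit is $$0=\partial_th^{\mathrm{OM}}+\mathrm{div}_x\Big(h^{\mathrm{OM}}\int G(x,\hat x,u)\hat h^{\mathrm{OM}}d\hat xd\hat\lambda\Big)-\mathrm{div}_\lambda\Big(h^{\mathrm{OM}}\Big[\int\big(D_1G(x,\hat x,u)^\top\lambda+D_2G(\hat x,x,u)^\top\hat\lambda\big)\hat h^{\mathrm{OM}}d\hat xd\hat\lambda+D\tilde m(x)^\top\nabla_mJ(u,m_{h^{\mathrm{OM}}}(t))\Big]\Big),$$ $$0=\nabla_uJ(u,m_{h^{\mathrm{OM}}}(t))+\alpha u+\int D_uG(x,\hat x,u)^\top\lambda\,h^{\mathrm{OM}}\hat h^{\mathrm{OM}}\,d\hat xd\hat\lambda dxd\lambda .$$ **Optimality conditions of (B)** (formal, $L^2$ sense): the state equation of (B) together with $$0=\nabla_mJ(u,m_{h^{\mathrm{MO}}}(t))^\top\tilde m(x)-\partial_t\Lambda-\int\big(G(x,\hat x,u)^\top\nabla_x\Lambda+G(\hat x,x,u)^\top\nabla_{\hat x}\hat\Lambda\big)\hat h^{\mathrm{MO}}d\hat x,\qquad\Lambda(T,x)=0,$$ $$0=\nabla_uJ(u,m_{h^{\mathrm{MO}}}(t))+\alpha u-\int D_uG(x,\hat x,u)^\top\nabla_x\Lambda\,h^{\mathrm{MO}}\hat h^{\mathrm{MO}}\,d\hat xdx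 .$$
   Formalization: The relations fix only the mean of h2^OM, so (B)'s conditions cannot imply the full kinetic equation; the converse is stated for its moments in 1 and λ. λ_i(T)=0, impossible for a density, becomes a vanishing first λ-moment at T. *)

theory Defs
  imports "HOL-Analysis.Analysis"
begin

section \<open>Vector calculus\<close>

definition grad :: "(real^'a \<Rightarrow> real) \<Rightarrow> real^'a \<Rightarrow> real^'a" where
  "grad f x = (\<chi> i. frechet_derivative f (at x) (axis i 1))"

definition divg :: "(real^'a \<Rightarrow> real^'a) \<Rightarrow> real^'a \<Rightarrow> real" where
  "divg F x = trace (jacobian F (at x))"

text \<open>The topological support, at a fixed time, of a density.\<close>

definition supp :: "('a::topological_space \<Rightarrow> real) \<Rightarrow> 'a set" where
  "supp f = closure {x. f x \<noteq> 0}"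

section \<open>Regularity and decay\<close>

text \<open>
  These predicates make ``regular and decaying enough for differentiation and integration by
  parts'' precise. On the time slab \<open>{0..T} \<times> UNIV\<close> the derivative is the one within the slab,
  i.e. one-sided in time at \<open>0\<close> and \<open>T\<close>.
\<close>

definition C1_on :: "('a::real_normed_vector \<Rightarrow> 'b::real_normed_vector) \<Rightarrow> 'a set \<Rightarrow> bool" where
  "C1_on f S \<longleftrightarrow> (\<exists>f' :: 'a \<Rightarrow> 'a \<Rightarrow>\<^sub>L 'b.
     (\<forall>p\<in>S. (f has_derivative blinfun_apply (f' p)) (at p within S)) \<and> continuous_on S f')"

definition C2_on :: "('a::real_normed_vector \<Rightarrow> 'b::real_normed_vector) \<Rightarrow> 'a set \<Rightarrow> bool" where
  "C2_on f S \<longleftrightarrow> (\<exists>f' :: 'a \<Rightarrow> 'a \<Rightarrow>\<^sub>L 'b.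
     (\<forall>p\<in>S. (f has_derivative blinfun_apply (f' p)) (at p within S)) \<and> C1_on f' S)"

text \<open>
  \<open>h\<close> is continuously differentiable on \<open>[0,T] \<times> \<real>\<^sup>n \<times> \<real>\<^sup>n\<close>, and \<open>h\<close> and its first derivatives
  decay in \<open>(x,\<lambda>)\<close> faster than any power, uniformly in time.
\<close>

definition regular_density ::
  "real \<Rightarrow> (real \<Rightarrow> real^'n \<Rightarrow> real^'n \<Rightarrow> real) \<Rightarrow> bool" where
  "regular_density T h \<longleftrightarrow> (\<exists>h' :: real \<times> (real^'n) \<times> (real^'n) \<Rightarrow> (real \<times> (real^'n) \<times> (real^'n)) \<Rightarrow>\<^sub>L real.
     (\<forall>p\<in>{0..T} \<times> UNIV.
        ((\<lambda>(t, x, l). h t x l) has_derivative blinfun_apply (h' p)) (at p within {0..T} \<times> UNIV)) \<and>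
     continuous_on ({0..T} \<times> UNIV) h' \<and>
     (\<forall>k::nat. \<exists>C. \<forall>t\<in>{0..T}. \<forall>x l.
        (1 + norm x + norm l) ^ k * (\<bar>h t x l\<bar> + norm (h' (t, x, l))) \<le> C))"

text \<open>\<open>G\<close> is continuously differentiable; for each value of the control, \<open>G\<close> and its
  derivative grow at most polynomially in the two states.\<close>

definition regular_interaction ::
  "(real^'n \<Rightarrow> real^'n \<Rightarrow> real^'k \<Rightarrow> real^'n) \<Rightarrow> bool" where
  "regular_interaction G \<longleftrightarrow> (\<exists>G' :: (real^'n) \<times> (real^'n) \<times> (real^'k) \<Rightarrow> ((real^'n) \<times> (real^'n) \<times> (real^'k)) \<Rightarrow>\<^sub>L (real^'n).
     (\<forall>p. ((\<lambda>(x, y, w). G x y w) has_derivative blinfun_apply (G' p)) (at p)) \<and>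
     continuous_on UNIV G' \<and>
     (\<forall>w. \<exists>C k. \<forall>x y.
        norm (G x y w) + norm (G' (x, y, w)) \<le> C * (1 + norm x + norm y) ^ k))"

definition regular_observable :: "(real^'n \<Rightarrow> real^'n) \<Rightarrow> bool" where
  "regular_observable mt \<longleftrightarrow> C1_on mt UNIV \<and>
     (\<exists>C k. \<forall>x. norm (mt x) \<le> C * (1 + norm x) ^ k)"

section \<open>Mean-field limit of the optimality conditions of the agent problem\<close>

text \<open>
  Throughout, \<open>h\<close> is a density of \<open>(t, x, \<lambda>)\<close>, \<open>f = h t\<close> its value at a fixed time, and
  \<open>w = u t\<close> the value of the control there. The hatted variables are the components of
  \<open>z\<close> below, and \<open>(y, \<mu>)\<close> in \<open>om_control\<close>.
\<close>

definition D1 :: "(real^'n \<Rightarrow> real^'n \<Rightarrow> real^'k \<Rightarrow> real^'n) \<Rightarrow> real^'n \<Rightarrow> real^'n \<Rightarrow> real^'k \<Rightarrow> real^'n^'n" where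
  "D1 G x y w = jacobian (\<lambda>x'. G x' y w) (at x)"

definition D2 :: "(real^'n \<Rightarrow> real^'n \<Rightarrow> real^'k \<Rightarrow> real^'n) \<Rightarrow> real^'n \<Rightarrow> real^'n \<Rightarrow> real^'k \<Rightarrow> real^'n^'n" where
  "D2 G x y w = jacobian (\<lambda>y'. G x y' w) (at y)"

definition Du :: "(real^'n \<Rightarrow> real^'n \<Rightarrow> real^'k \<Rightarrow> real^'n) \<Rightarrow> real^'n \<Rightarrow> real^'n \<Rightarrow> real^'k \<Rightarrow> real^'k^'n" where
  "Du G x y w = jacobian (\<lambda>w'. G x y w') (at w)"

definition om_mean :: "(real^'n \<Rightarrow> real^'n) \<Rightarrow> (real^'n \<Rightarrow> real^'n \<Rightarrow> real) \<Rightarrow> real^'n" where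
  "om_mean mt f = (LINT z|lborel. f (fst z) (snd z) *\<^sub>R mt (fst z))"

definition om_velocity ::
  "(real^'n \<Rightarrow> real^'n \<Rightarrow> real^'k \<Rightarrow> real^'n) \<Rightarrow> real^'k \<Rightarrow> (real^'n \<Rightarrow> real^'n \<Rightarrow> real) \<Rightarrow> real^'n \<Rightarrow> real^'n" where
  "om_velocity G w f x = (LINT z|lborel. f (fst z) (snd z) *\<^sub>R G x (fst z) w)"

definition om_force ::
  "(real^'n \<Rightarrow> real^'n \<Rightarrow> real^'k \<Rightarrow> real^'n) \<Rightarrow> (real^'k \<Rightarrow> real^'n \<Rightarrow> real) \<Rightarrow> (real^'n \<Rightarrow> real^'n) \<Rightarrow>
   real^'k \<Rightarrow> (real^'n \<Rightarrow> real^'n \<Rightarrow> real) \<Rightarrow> real^'n \<Rightarrow> real^'n \<Rightarrow> real^'n" where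
  "om_force G J mt w f x l =
     (LINT z|lborel. f (fst z) (snd z) *\<^sub>R
        (transpose (D1 G x (fst z) w) *v l + transpose (D2 G (fst z) x w) *v snd z)) +
     transpose (jacobian mt (at x)) *v grad (\<lambda>m. J w m) (om_mean mt f)"

definition om_kinetic ::
  "real \<Rightarrow> (real^'n \<Rightarrow> real^'n \<Rightarrow> real^'k \<Rightarrow> real^'n) \<Rightarrow> (real^'k \<Rightarrow> real^'n \<Rightarrow> real) \<Rightarrow> (real^'n \<Rightarrow> real^'n) \<Rightarrow>
   (real \<Rightarrow> real^'k) \<Rightarrow> (real \<Rightarrow> real^'n \<Rightarrow> real^'n \<Rightarrow> real) \<Rightarrow> real \<Rightarrow> real^'n \<Rightarrow> real^'n \<Rightarrow> real" where
  "om_kinetic T G J mt u h t x l =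
     vector_derivative (\<lambda>s. h s x l) (at t within {0..T})
     + divg (\<lambda>y. h t y l *\<^sub>R om_velocity G (u t) (h t) y) x
     - divg (\<lambda>\<mu>. h t x \<mu> *\<^sub>R om_force G J mt (u t) (h t) x \<mu>) l"

definition om_control ::
  "real \<Rightarrow> (real^'n \<Rightarrow> real^'n \<Rightarrow> real^'k \<Rightarrow> real^'n) \<Rightarrow> (real^'k \<Rightarrow> real^'n \<Rightarrow> real) \<Rightarrow> (real^'n \<Rightarrow> real^'n) \<Rightarrow>
   real^'k \<Rightarrow> (real^'n \<Rightarrow> real^'n \<Rightarrow> real) \<Rightarrow> real^'k" where
  "om_control \<alpha> G J mt w f =
     grad (\<lambda>w'. J w' (om_mean mt f)) w + \<alpha> *\<^sub>R w +
     (LINT p|lborel. (case p of ((x, l), (y, \<mu>)) \<Rightarrow>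
        (f x l * f y \<mu>) *\<^sub>R (transpose (Du G x y w) *v l)))"

text \<open>
  The initial data prescribe only the state marginal, because the multipliers carry no initial
  condition. The terminal condition \<open>\<lambda>\<^sub>i(T) = 0\<close> enters as the vanishing of the first
  \<open>\<lambda>\<close>-moment at \<open>T\<close>: that all multipliers vanish would make the law at \<open>T\<close> a point mass in
  \<open>\<lambda>\<close>, which no density can satisfy. As a hypothesis this is weaker than \<open>\<lambda>\<^sub>i(T) = 0\<close>.
\<close>

definition om_boundary ::
  "real \<Rightarrow> (real^'n \<Rightarrow> real) \<Rightarrow> (real \<Rightarrow> real^'n \<Rightarrow> real^'n \<Rightarrow> real) \<Rightarrow> bool" where
  "om_boundary T h0 h \<longleftrightarrow>
     (\<forall>x. (LINT l|lborel. h 0 x l) = h0 x) \<and>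
     (\<forall>x. (LINT l|lborel. h T x l *\<^sub>R l) = 0)"

definition om_system ::
  "real \<Rightarrow> real \<Rightarrow> (real^'n \<Rightarrow> real^'n \<Rightarrow> real^'k \<Rightarrow> real^'n) \<Rightarrow> (real^'k \<Rightarrow> real^'n \<Rightarrow> real) \<Rightarrow>
   (real^'n \<Rightarrow> real^'n) \<Rightarrow> (real^'n \<Rightarrow> real) \<Rightarrow> (real \<Rightarrow> real^'k) \<Rightarrow> (real \<Rightarrow> real^'n \<Rightarrow> real^'n \<Rightarrow> real) \<Rightarrow> bool" where
  "om_system T \<alpha> G J mt h0 u h \<longleftrightarrow>
     om_boundary T h0 h \<and>
     (\<forall>t\<in>{0..T}. \<forall>x l. om_kinetic T G J mt u h t x l = 0) \<and>
     (\<forall>t\<in>{0..T}. om_control \<alpha> G J mt (u t) (h t) = 0)"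

text \<open>
  The content of \<open>om_system\<close> for the two \<open>\<lambda>\<close>-moments \<open>\<integral> h d\<lambda>\<close> and \<open>\<integral> \<lambda> h d\<lambda>\<close>: the kinetic
  equation is integrated against \<open>1\<close> and against \<open>\<lambda>\<close>. Nothing else about the conditional density
  is visible in \<open>\<nabla>\<^sub>x\<Lambda>\<close>.
\<close>

definition om_moment_system ::
  "real \<Rightarrow> real \<Rightarrow> (real^'n \<Rightarrow> real^'n \<Rightarrow> real^'k \<Rightarrow> real^'n) \<Rightarrow> (real^'k \<Rightarrow> real^'n \<Rightarrow> real) \<Rightarrow>
   (real^'n \<Rightarrow> real^'n) \<Rightarrow> (real^'n \<Rightarrow> real) \<Rightarrow> (real \<Rightarrow> real^'k) \<Rightarrow> (real \<Rightarrow> real^'n \<Rightarrow> real^'n \<Rightarrow> real) \<Rightarrow> bool" where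
  "om_moment_system T \<alpha> G J mt h0 u h \<longleftrightarrow>
     om_boundary T h0 h \<and>
     (\<forall>t\<in>{0..T}. \<forall>x. (LINT l|lborel. om_kinetic T G J mt u h t x l) = 0 \<and>
                       (LINT l|lborel. om_kinetic T G J mt u h t x l *\<^sub>R l) = 0) \<and>
     (\<forall>t\<in>{0..T}. om_control \<alpha> G J mt (u t) (h t) = 0)"

section \<open>Optimality conditions of the mean-field problem\<close>

definition mo_mean :: "(real^'n \<Rightarrow> real^'n) \<Rightarrow> (real^'n \<Rightarrow> real) \<Rightarrow> real^'n" where
  "mo_mean mt f = (LINT x|lborel. f x *\<^sub>R mt x)"

definition mo_velocity ::
  "(real^'n \<Rightarrow> real^'n \<Rightarrow> real^'k \<Rightarrow> real^'n) \<Rightarrow> real^'k \<Rightarrow> (real^'n \<Rightarrow> real) \<Rightarrow> real^'n \<Rightarrow> real^'n" where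
  "mo_velocity G w f x = (LINT y|lborel. f y *\<^sub>R G x y w)"

definition mo_state ::
  "real \<Rightarrow> (real^'n \<Rightarrow> real^'n \<Rightarrow> real^'k \<Rightarrow> real^'n) \<Rightarrow> (real \<Rightarrow> real^'k) \<Rightarrow>
   (real \<Rightarrow> real^'n \<Rightarrow> real) \<Rightarrow> real \<Rightarrow> real^'n \<Rightarrow> real" where
  "mo_state T G u h t x =
     vector_derivative (\<lambda>s. h s x) (at t within {0..T})
     + divg (\<lambda>y. h t y *\<^sub>R mo_velocity G (u t) (h t) y) x"

definition mo_adjoint ::
  "real \<Rightarrow> (real^'n \<Rightarrow> real^'n \<Rightarrow> real^'k \<Rightarrow> real^'n) \<Rightarrow> (real^'k \<Rightarrow> real^'n \<Rightarrow> real) \<Rightarrow> (real^'n \<Rightarrow> real^'n) \<Rightarrow>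
   (real \<Rightarrow> real^'k) \<Rightarrow> (real \<Rightarrow> real^'n \<Rightarrow> real) \<Rightarrow> (real \<Rightarrow> real^'n \<Rightarrow> real) \<Rightarrow> real \<Rightarrow> real^'n \<Rightarrow> real" where
  "mo_adjoint T G J mt u h \<Lambda> t x =
     grad (\<lambda>m. J (u t) m) (mo_mean mt (h t)) \<bullet> mt x
     - vector_derivative (\<lambda>s. \<Lambda> s x) (at t within {0..T})
     - (LINT y|lborel. (G x y (u t) \<bullet> grad (\<Lambda> t) x + G y x (u t) \<bullet> grad (\<Lambda> t) y) * h t y)"

definition mo_control ::
  "real \<Rightarrow> (real^'n \<Rightarrow> real^'n \<Rightarrow> real^'k \<Rightarrow> real^'n) \<Rightarrow> (real^'k \<Rightarrow> real^'n \<Rightarrow> real) \<Rightarrow> (real^'n \<Rightarrow> real^'n) \<Rightarrow>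
   real^'k \<Rightarrow> (real^'n \<Rightarrow> real) \<Rightarrow> (real^'n \<Rightarrow> real) \<Rightarrow> real^'k" where
  "mo_control \<alpha> G J mt w f L =
     grad (\<lambda>w'. J w' (mo_mean mt f)) w + \<alpha> *\<^sub>R w -
     (LINT p|lborel. (case p of (x, y) \<Rightarrow>
        (f x * f y) *\<^sub>R (transpose (Du G x y w) *v grad L x)))"

text \<open>
  The adjoint equation and \<open>\<Lambda>(T,x) = 0\<close> appear after applying \<open>\<nabla>\<^sub>x\<close> and on the support of \<open>h\<close>,
  which is where \<open>\<nabla>\<^sub>x\<Lambda>\<close> is identified. \<open>has_derivative (\<lambda>_. 0)\<close> says that the left-hand side of
  the adjoint equation is differentiable in \<open>x\<close> with vanishing gradient.
\<close>

definition mo_system ::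
  "real \<Rightarrow> real \<Rightarrow> (real^'n \<Rightarrow> real^'n \<Rightarrow> real^'k \<Rightarrow> real^'n) \<Rightarrow> (real^'k \<Rightarrow> real^'n \<Rightarrow> real) \<Rightarrow>
   (real^'n \<Rightarrow> real^'n) \<Rightarrow> (real^'n \<Rightarrow> real) \<Rightarrow> (real \<Rightarrow> real^'k) \<Rightarrow>
   (real \<Rightarrow> real^'n \<Rightarrow> real) \<Rightarrow> (real \<Rightarrow> real^'n \<Rightarrow> real) \<Rightarrow> bool" where
  "mo_system T \<alpha> G J mt h0 u h \<Lambda> \<longleftrightarrow>
     (\<forall>x. h 0 x = h0 x) \<and>
     (\<forall>t\<in>{0..T}. \<forall>x. mo_state T G u h t x = 0) \<and>
     (\<forall>t\<in>{0..T}. \<forall>x\<in>supp (h t). (mo_adjoint T G J mt u h \<Lambda> t has_derivative (\<lambda>_. 0)) (at x)) \<and>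
     (\<forall>x\<in>supp (h T). grad (\<Lambda> T) x = 0) \<and>
     (\<forall>t\<in>{0..T}. mo_control \<alpha> G J mt (u t) (h t) (\<Lambda> t) = 0)"

end

theory Submission
  imports Defs
begin

text \<open>
  Only two \<open>\<lambda>\<close>-moments of the mean-field limit matter: the state density
  \<open>\<rho> = \<integral> h d\<lambda>\<close> and the momentum \<open>m = \<integral> \<lambda> h d\<lambda>\<close>. The factorisation and the identification of
  \<open>\<nabla>\<^sub>x\<Lambda>\<close> say exactly that \<open>m = - \<rho> \<nabla>\<^sub>x\<Lambda>\<close>, on and off the support. The zeroth moment of the kinetic
  equation is the state equation for \<open>\<rho>\<close>. In the first moment, integration by parts in \<open>\<lambda>\<close> turns the
  force term into \<open>+ \<integral> h F d\<lambda>\<close>; inserting \<open>m = - \<rho> \<nabla>\<^sub>x\<Lambda>\<close> and the symmetry of the second derivative of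
  \<open>\<Lambda>\<close> gives \<open>\<rho> \<nabla>\<^sub>xA - S \<nabla>\<^sub>x\<Lambda>\<close>, where \<open>S\<close> and \<open>A\<close> are the left-hand sides of the state and adjoint
  equations. So once \<open>S = 0\<close>, the first moment vanishes iff \<open>\<nabla>\<^sub>xA = 0\<close> where \<open>\<rho> \<noteq> 0\<close>, hence by continuity on
  the support. The two control equations agree by Fubini.
\<close>

section \<open>Vector calculus\<close>

text \<open>Three obstacles shape the proof. \<rho> may vanish, so \<nabla>\<Lambda> cannot be
  recovered as a quotient; the product identity for m is differentiated as it stands and never
  divided by \<rho>. \<Lambda> is only C2, with no bound on its growth: integrals over all states
  that contain \<rho> \<nabla>\<Lambda> converge because this product is -m, and m inherits rapid
  decay from the phase-space density, as \<rho> inherits its smoothness. Finally, the equations are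
  required up to t = 0 and t = T, where joint derivatives in (t, x) are one-sided in time, so
  uniqueness of derivatives and symmetry of second derivatives must both be available within the
  slab. Two moments suffice because the velocity does not contain \<lambda> and the force is affine
  in \<lambda>: the moments of order zero and one form a closed system. Vector equations are
  compared after pairing with a fixed e, which moves the transposed Jacobians onto e and leaves
  scalar identities.\<close>

lemma jacobian_mult:
  fixes f :: "real^'n \<Rightarrow> real^'m"
  assumes "(f has_derivative f') (at x)"
  shows "jacobian f (at x) *v v = f' v"
  unfolding jacobian_def frechet_derivative_at[OF assms, symmetric]
  by (rule fun_cong[OF matrix_vector_mul(2)[OF has_derivative_linear[OF assms]]])

lemma inner_transpose_mult:
  fixes A :: "real^'n^'m"
  shows "(transpose A *v l) \<bullet> e = l \<bullet> (A *v e)"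
  by (simp add: dot_lmul_matrix)

text \<open>Serves integrands containing transposed Jacobians: these are tractable only after
  pairing with a vector, so integrability is known for the scalar products first.\<close>

lemma integrable_vecI:
  fixes F :: "'a \<Rightarrow> real^'n"
  assumes "\<And>i. integrable M (\<lambda>x. F x \<bullet> axis i 1)"
  shows "integrable M F"
proof -
  have "integrable M (\<lambda>x. \<Sum>i\<in>UNIV. (F x \<bullet> axis i 1) *\<^sub>R axis i (1::real))"
    using assms by (intro Bochner_Integration.integrable_sum integrable_scaleR_left)
  moreover have "(\<Sum>i\<in>UNIV. (F x \<bullet> axis i 1) *\<^sub>R axis i (1::real)) = F x" for x
    using basis_expansion[of "F x"] by (simp add: scalar_mult_eq_scaleR inner_axis)
  ultimately show ?thesis by simp
qed

lemma divg_eq: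
  assumes "(F has_derivative F') (at x)"
  shows "divg F x = (\<Sum>i\<in>UNIV. F' (axis i 1) $ i)"
  using frechet_derivative_at[OF assms]
  by (simp add: divg_def jacobian_def trace_def matrix_def)

text \<open>Product rule for div(gV): the coordinate sum of V_i times the partial derivatives of g
  recombines, by linearity of \<open>g'\<close>, into one directional derivative along V. In this
  form transport terms merge with time derivatives.\<close>

lemma divg_scaleR:
  fixes V :: "real^'n \<Rightarrow> real^'n"
  assumes g: "(g has_derivative g') (at x)" and V: "(V has_derivative V') (at x)"
  shows "divg (\<lambda>y. g y *\<^sub>R V y) x = g' (V x) + g x * divg V x"
proof -
  have lin: "linear g'"
    using g by (rule has_derivative_linear)
  have "((\<lambda>y. g y *\<^sub>R V y) has_derivative (\<lambda>d. g x *\<^sub>R V' d + g' d *\<^sub>R V x)) (at x)"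
    by (rule has_derivative_scaleR[OF g V])
  then have "divg (\<lambda>y. g y *\<^sub>R V y) x = (\<Sum>i\<in>UNIV. (g x *\<^sub>R V' (axis i 1) + g' (axis i 1) *\<^sub>R V x) $ i)"
    by (rule divg_eq)
  also have "\<dots> = g x * divg V x + (\<Sum>i\<in>UNIV. V x $ i * g' (axis i 1))"
    by (simp add: divg_eq[OF V] sum.distrib sum_distrib_left mult.commute)
  also have "(\<Sum>i\<in>UNIV. V x $ i * g' (axis i 1)) = g' (\<Sum>i\<in>UNIV. V x $ i *\<^sub>R axis i 1)"
    by (simp add: linear_sum[OF lin] linear_cmul[OF lin])
  also have "(\<Sum>i\<in>UNIV. V x $ i *\<^sub>R axis i 1) = V x"
    using basis_expansion[of "V x"] by (simp add: scalar_mult_eq_scaleR)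
  finally show ?thesis by simp
qed

lemma grad_inner:
  assumes "(f has_derivative f') (at x)"
  shows "grad f x \<bullet> v = f' v"
proof -
  have lin: "linear f'"
    using assms by (rule has_derivative_linear)
  have "grad f x \<bullet> v = (\<Sum>i\<in>UNIV. v $ i * f' (axis i 1))"
    by (simp add: grad_def inner_vec_def frechet_derivative_at[OF assms, symmetric] mult.commute)
  also have "\<dots> = f' (\<Sum>i\<in>UNIV. v $ i *\<^sub>R axis i 1)"
    by (simp add: linear_sum[OF lin] linear_cmul[OF lin])
  also have "(\<Sum>i\<in>UNIV. v $ i *\<^sub>R axis i 1) = v"
    using basis_expansion[of v] by (simp add: scalar_mult_eq_scaleR)
  finally show ?thesis .
qed

lemma not_in_supp: "x \<notin> supp f \<Longrightarrow> f x = 0"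
  unfolding supp_def using closure_subset[of "{x. f x \<noteq> 0}"] by auto

text \<open>The zero set of a continuous g is closed, hence contains the closure of the points where
  f is nonzero. This is the bridge between conditions on the support and equations weighted with the
  density.\<close>

lemma vanishing_on_supp_iff:
  fixes g :: "'a::topological_space \<Rightarrow> 'b::real_normed_vector"
  assumes "continuous_on UNIV g"
  shows "(\<forall>x\<in>supp f. g x = 0) \<longleftrightarrow> (\<forall>x. f x *\<^sub>R g x = 0)"
proof
  assume "\<forall>x\<in>supp f. g x = 0"
  then show "\<forall>x. f x *\<^sub>R g x = 0" using not_in_supp by force
next
  assume "\<forall>x. f x *\<^sub>R g x = 0"
  then have "{x. f x \<noteq> 0} \<subseteq> {x. g x = 0}" by auto
  moreover have "closed {x. g x = 0}"
    by (intro closed_Collect_eq assms continuous_on_const)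
  ultimately have "supp f \<subseteq> {x. g x = 0}"
    unfolding supp_def by (rule closure_minimal)
  then show "\<forall>x\<in>supp f. g x = 0" by auto
qed

section \<open>Differentiation on a closed time slab\<close>

text \<open>Restriction to the two slices through (t, x). The spatial slice is the whole space, so
  the spatial derivative is unrestricted even at t = 0 and t = T; only the time derivative stays
  one-sided.\<close>

lemma slab_partial_derivatives:
  fixes F :: "real \<times> 'a::real_normed_vector \<Rightarrow> 'b::real_normed_vector"
  assumes F: "(F has_derivative F') (at (t, x) within {0..T} \<times> UNIV)" and t: "t \<in> {0..T}"
  shows "((\<lambda>s. F (s, x)) has_vector_derivative F' (1, 0)) (at t within {0..T})"
    and "((\<lambda>y. F (t, y)) has_derivative (\<lambda>v. F' (0, v))) (at x)"
proof -
  have lin: "linear F'"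
    using F by (rule has_derivative_linear)
  have "((\<lambda>s. F (s, x)) has_derivative (\<lambda>d. F' (d, 0))) (at t within {0..T})"
  proof (rule has_derivative_in_compose[where f="\<lambda>s. (s, x)" and g=F])
    show "(F has_derivative F') (at (t, x) within (\<lambda>s. (s, x)) ` {0..T})"
      by (rule has_derivative_subset[OF F]) auto
  qed (auto intro!: derivative_eq_intros)
  moreover have "(\<lambda>d. F' (d, 0)) = (\<lambda>d. d *\<^sub>R F' (1, 0))"
  proof
    show "F' (d, 0) = d *\<^sub>R F' (1, 0)" for d
      using linear_cmul[OF lin, of d "(1, 0)"] by simp
  qed
  ultimately show "((\<lambda>s. F (s, x)) has_vector_derivative F' (1, 0)) (at t within {0..T})"
    unfolding has_vector_derivative_def by simp
  show "((\<lambda>y. F (t, y)) has_derivative (\<lambda>v. F' (0, v))) (at x)"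
  proof (rule has_derivative_in_compose[where f="\<lambda>y. (t, y)" and g=F])
    show "(F has_derivative F') (at (t, x) within (\<lambda>y. (t, y)) ` UNIV)"
      by (rule has_derivative_subset[OF F]) (use t in auto)
  qed (auto intro!: derivative_eq_intros)
qed

text \<open>
  Only a corner at \<open>p\<close> spanned by \<open>i\<close> and \<open>j\<close> has to lie in \<open>S\<close>, so the lemma also applies at the end points
  of a time slab.
\<close>

lemma second_derivative_symmetric_within:
  fixes f :: "'a::real_normed_vector \<Rightarrow> real" and f' :: "'a \<Rightarrow> 'a \<Rightarrow>\<^sub>L real"
    and f'' :: "'a \<Rightarrow> 'a \<Rightarrow>\<^sub>L 'a \<Rightarrow>\<^sub>L real"
  assumes f': "\<And>p. p \<in> S \<Longrightarrow> (f has_derivative f' p) (at p within S)"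
    and f'': "\<And>p. p \<in> S \<Longrightarrow> (f' has_derivative f'' p) (at p within S)"
    and cont: "continuous_on S f''"
    and \<delta>: "\<delta> > 0"
    and corner: "\<And>\<sigma> \<tau>. \<sigma> \<in> {0..\<delta>} \<Longrightarrow> \<tau> \<in> {0..\<delta>} \<Longrightarrow> p + \<sigma> *\<^sub>R i + \<tau> *\<^sub>R j \<in> S"
  shows "f'' p i j = f'' p j i"
proof -
  \<comment> \<open>The second difference of f over the parallelogram with sides s i and s j. It is
    symmetric in i and j, while its quotient by the square of s tends to either mixed derivative,
    depending on the order in which the two directions are treated.\<close>
  define \<Delta> where "\<Delta> = (\<lambda>i j s. f (p + s *\<^sub>R i + s *\<^sub>R j) - f (p + s *\<^sub>R i) - f (p + s *\<^sub>R j) + f p)"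
  have lim: "((\<lambda>s. \<Delta> i j s / s\<^sup>2) \<longlongrightarrow> f'' p j i) (at_right 0)"
    if corner: "\<And>\<sigma> \<tau>. \<sigma> \<in> {0..\<delta>} \<Longrightarrow> \<tau> \<in> {0..\<delta>} \<Longrightarrow> p + \<sigma> *\<^sub>R i + \<tau> *\<^sub>R j \<in> S" for i j
  proof -
    \<comment> \<open>Mean value theorem twice: along i for the difference g of two parallel edges,
      then along j for the derivative in direction i. Both intermediate points stay in the corner,
      so all derivatives are taken within S.\<close>
    have mv: "\<exists>\<sigma>\<in>{0..s}. \<exists>\<tau>\<in>{0..s}. \<Delta> i j s = s\<^sup>2 * f'' (p + \<sigma> *\<^sub>R i + \<tau> *\<^sub>R j) j i"
      if s: "s > 0" "s \<le> \<delta>" for s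
    proof -
      define g where "g = (\<lambda>\<sigma>. f (p + \<sigma> *\<^sub>R i + s *\<^sub>R j) - f (p + \<sigma> *\<^sub>R i))"
      have der: "((\<lambda>\<sigma>. f (p + \<sigma> *\<^sub>R i + r *\<^sub>R j)) has_derivative (\<lambda>d. f' (p + \<sigma> *\<^sub>R i + r *\<^sub>R j) (d *\<^sub>R i)))
          (at \<sigma> within {0..s})" if "\<sigma> \<in> {0..s}" "r \<in> {0..s}" for \<sigma> r
      proof (rule has_derivative_in_compose2[where g=f and t=S and g'="\<lambda>p. f' p" and f="\<lambda>\<sigma>. p + \<sigma> *\<^sub>R i + r *\<^sub>R j"])
        show "(\<lambda>\<sigma>. p + \<sigma> *\<^sub>R i + r *\<^sub>R j) ` {0..s} \<subseteq> S"
          using corner that s by auto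
      qed (use f' that in \<open>auto intro!: derivative_eq_intros\<close>)
      have "\<exists>\<sigma>\<in>{0..s}. g s - g 0 = f' (p + \<sigma> *\<^sub>R i + s *\<^sub>R j) ((s - 0) *\<^sub>R i) - f' (p + \<sigma> *\<^sub>R i) ((s - 0) *\<^sub>R i)"
        unfolding g_def
        by (rule mvt_very_simple[where f'="\<lambda>\<sigma> d. f' (p + \<sigma> *\<^sub>R i + s *\<^sub>R j) (d *\<^sub>R i) - f' (p + \<sigma> *\<^sub>R i) (d *\<^sub>R i)"])
          (use s in \<open>auto intro!: has_derivative_diff der der[of _ 0, simplified]\<close>)
      then obtain \<sigma> where \<sigma>: "\<sigma> \<in> {0..s}"
        and g: "g s - g 0 = s * (f' (p + \<sigma> *\<^sub>R i + s *\<^sub>R j) i - f' (p + \<sigma> *\<^sub>R i) i)"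
        by (auto simp: blinfun.scaleR_right algebra_simps)
      have "\<exists>\<tau>\<in>{0..s}. f' (p + \<sigma> *\<^sub>R i + s *\<^sub>R j) i - f' (p + \<sigma> *\<^sub>R i + 0 *\<^sub>R j) i
          = f'' (p + \<sigma> *\<^sub>R i + \<tau> *\<^sub>R j) ((s - 0) *\<^sub>R j) i"
      proof (rule mvt_very_simple[where f'="\<lambda>\<tau> d. f'' (p + \<sigma> *\<^sub>R i + \<tau> *\<^sub>R j) (d *\<^sub>R j) i"])
        fix \<tau> assume \<tau>: "0 \<le> \<tau>" "\<tau> \<le> s"
        have "((\<lambda>\<tau>. f' (p + \<sigma> *\<^sub>R i + \<tau> *\<^sub>R j)) has_derivative (\<lambda>d. f'' (p + \<sigma> *\<^sub>R i + \<tau> *\<^sub>R j) (d *\<^sub>R j)))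
          (at \<tau> within {0..s})"
        proof (rule has_derivative_in_compose2[where g=f' and t=S and g'="\<lambda>p. f'' p" and f="\<lambda>\<tau>. p + \<sigma> *\<^sub>R i + \<tau> *\<^sub>R j"])
          show "(\<lambda>\<tau>. p + \<sigma> *\<^sub>R i + \<tau> *\<^sub>R j) ` {0..s} \<subseteq> S"
            using corner \<sigma> s by auto
        qed (use f'' \<tau> in \<open>auto intro!: derivative_eq_intros\<close>)
        then show "((\<lambda>\<tau>. f' (p + \<sigma> *\<^sub>R i + \<tau> *\<^sub>R j) i) has_derivative (\<lambda>d. f'' (p + \<sigma> *\<^sub>R i + \<tau> *\<^sub>R j) (d *\<^sub>R j) i))
          (at \<tau> within {0..s})"
          by (auto intro!: derivative_eq_intros)
      qed (use s in auto)
      then obtain \<tau> where "\<tau> \<in> {0..s}"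
        and "f' (p + \<sigma> *\<^sub>R i + s *\<^sub>R j) i - f' (p + \<sigma> *\<^sub>R i) i = s * f'' (p + \<sigma> *\<^sub>R i + \<tau> *\<^sub>R j) j i"
        by (auto simp: blinfun.scaleR_right blinfun.scaleR_left)
      moreover have "\<Delta> i j s = g s - g 0" by (simp add: \<Delta>_def g_def)
      ultimately show ?thesis
        using \<sigma> g by (intro bexI[of _ \<sigma>] bexI[of _ \<tau>]) (auto simp: power2_eq_square)
    qed
    then have "\<forall>s. \<exists>\<sigma> \<tau>. 0 < s \<and> s \<le> \<delta> \<longrightarrow> \<sigma> \<in> {0..s} \<and> \<tau> \<in> {0..s} \<and> \<Delta> i j s = s\<^sup>2 * f'' (p + \<sigma> *\<^sub>R i + \<tau> *\<^sub>R j) j i"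
      by blast
    then obtain \<sigma> \<tau> where st: "\<And>s. 0 < s \<Longrightarrow> s \<le> \<delta> \<Longrightarrow> \<sigma> s \<in> {0..s} \<and> \<tau> s \<in> {0..s} \<and>
        \<Delta> i j s = s\<^sup>2 * f'' (p + \<sigma> s *\<^sub>R i + \<tau> s *\<^sub>R j) j i"
      by metis
    have ev: "\<forall>\<^sub>F s in at_right 0. 0 < s \<and> s \<le> \<delta>"
      using eventually_at_right_real[OF \<delta>] by eventually_elim auto
    have to0: "(\<sigma> \<longlongrightarrow> 0) (at_right 0)" "(\<tau> \<longlongrightarrow> 0) (at_right 0)"
      by (rule tendsto_sandwich[where f="\<lambda>_. 0" and h="\<lambda>s. s"]; use st ev in \<open>force elim: eventually_mono\<close>)+
    have "((\<lambda>s. p + \<sigma> s *\<^sub>R i + \<tau> s *\<^sub>R j) \<longlongrightarrow> p + 0 *\<^sub>R i + 0 *\<^sub>R j) (at_right 0)"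
      by (intro tendsto_intros to0)
    then have "((\<lambda>s. f'' (p + \<sigma> s *\<^sub>R i + \<tau> s *\<^sub>R j)) \<longlongrightarrow> f'' p) (at_right 0)"
    proof (intro continuous_on_tendsto_compose[OF cont])
      show "p \<in> S" using corner[of 0 0] \<delta> by simp
      show "\<forall>\<^sub>F s in at_right 0. p + \<sigma> s *\<^sub>R i + \<tau> s *\<^sub>R j \<in> S"
        using ev by eventually_elim (use corner st in \<open>force\<close>)
    qed simp
    then have "((\<lambda>s. f'' (p + \<sigma> s *\<^sub>R i + \<tau> s *\<^sub>R j) j i) \<longlongrightarrow> f'' p j i) (at_right 0)"
      by (intro tendsto_intros)
    moreover have "\<forall>\<^sub>F s in at_right 0. \<Delta> i j s / s\<^sup>2 = f'' (p + \<sigma> s *\<^sub>R i + \<tau> s *\<^sub>R j) j i"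
      using ev by eventually_elim (use st in auto)
    ultimately show ?thesis by (simp cong: tendsto_cong)
  qed
  have "\<Delta> j i = \<Delta> i j" by (auto simp: \<Delta>_def algebra_simps)
  moreover have "p + \<sigma> *\<^sub>R j + \<tau> *\<^sub>R i \<in> S" if "\<sigma> \<in> {0..\<delta>}" "\<tau> \<in> {0..\<delta>}" for \<sigma> \<tau>
    using corner[OF that(2,1)] by (simp add: ac_simps)
  ultimately have "((\<lambda>s. \<Delta> i j s / s\<^sup>2) \<longlongrightarrow> f'' p i j) (at_right 0)"
    using lim[of j i] by simp
  with lim[OF corner] show ?thesis
    using tendsto_unique[OF trivial_limit_at_right_real] by metis
qed

section \<open>Parametric integrals\<close>

text \<open>Dominated convergence for the remainder of the difference quotient. On the convex set S
  the bound on the derivatives makes each section Lipschitz with constant g y, so the normalised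
  remainder is at most 2 g. Derivatives within S are needed for time slabs.\<close>

lemma has_derivative_lebesgue_integral:
  fixes f :: "'a::real_normed_vector \<Rightarrow> 'b \<Rightarrow> 'c::{banach,second_countable_topology}"
  assumes S: "convex S" "a \<in> S"
    and deriv: "\<And>x y. x \<in> S \<Longrightarrow> ((\<lambda>x. f x y) has_derivative f' x y) (at x within S)"
    and bound: "\<And>x y v. x \<in> S \<Longrightarrow> norm (f' x y v) \<le> g y * norm v"
    and int: "\<And>x. x \<in> S \<Longrightarrow> integrable M (f x)"
    and g: "integrable M g"
    and meas: "\<And>v. (\<lambda>y. f' a y v) \<in> borel_measurable M"
  shows "((\<lambda>x. LINT y|M. f x y) has_derivative (\<lambda>v. LINT y|M. f' a y v)) (at a within S)"
proof -
  have int': "integrable M (\<lambda>y. f' a y v)" for v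
    by (rule Bochner_Integration.integrable_bound[OF integrable_mult_left[OF g, of "norm v"] meas])
      (auto intro!: always_eventually order_trans[OF bound[OF S(2)]])
  have lin: "bounded_linear (f' a y)" for y
    using deriv[OF S(2)] by (rule has_derivative_bounded_linear)
  have "bounded_linear (\<lambda>v. LINT y|M. f' a y v)"
  proof (rule bounded_linear_intro)
    show "(LINT y|M. f' a y (v + w)) = (LINT y|M. f' a y v) + (LINT y|M. f' a y w)" for v w
      by (simp add: linear_add[OF bounded_linear.linear[OF lin]] int')
    show "(LINT y|M. f' a y (r *\<^sub>R v)) = r *\<^sub>R (LINT y|M. f' a y v)" for r v
      by (simp add: linear_cmul[OF bounded_linear.linear[OF lin]])
    show "norm (LINT y|M. f' a y v) \<le> norm v * (LINT y|M. g y)" for v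
    proof -
      have "norm (LINT y|M. f' a y v) \<le> (LINT y|M. norm (f' a y v))"
        by (rule integral_norm_bound)
      also have "\<dots> \<le> (LINT y|M. g y * norm v)"
        using g int' bound[OF S(2)] by (intro integral_mono integrable_norm integrable_mult_left) auto
      finally show ?thesis by (simp add: mult.commute)
    qed
  qed
  moreover have "((\<lambda>x. (1 / norm (x - a)) *\<^sub>R ((LINT y|M. f x y) - ((LINT y|M. f a y) + (LINT y|M. f' a y (x - a)))))
      \<longlongrightarrow> 0) (at a within S)"
    unfolding tendsto_at_iff_sequentially
  proof (intro allI impI)
    fix X assume X: "\<forall>i. X i \<in> S - {a}" "X \<longlonglongrightarrow> a"
    define D where "D = (\<lambda>i y. (1 / norm (X i - a)) *\<^sub>R (f (X i) y - (f a y + f' a y (X i - a))))"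
    have XS: "X i \<in> S" and Xa: "norm (X i - a) > 0" for i using X(1) by auto
    have "(\<lambda>i. LINT y|M. D i y) \<longlonglongrightarrow> (LINT y|M. 0)"
    proof (rule integral_dominated_convergence)
      show "integrable M (\<lambda>y. 2 * g y)" using g by simp
      show "D i \<in> borel_measurable M" for i
        using int[OF XS, of i] int[OF S(2)] int' unfolding D_def by auto
      show "AE y in M. norm (D i y) \<le> 2 * g y" for i
      proof (intro always_eventually allI)
        fix y
        \<comment> \<open>No sign of g is assumed: the bound at the nonzero increment X i - a forces
          it.\<close>
        have gnn: "0 \<le> g y"
          using bound[OF S(2), of y "X i - a"] Xa[of i] norm_ge_zero[of "f' a y (X i - a)"]
          by (smt (verit) zero_le_mult_iff)
        have "norm (f (X i) y - f a y) \<le> g y * norm (X i - a)"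
        proof (rule differentiable_bound[OF S(1)])
          show "((\<lambda>x. f x y) has_derivative f' x y) (at x within S)" if "x \<in> S" for x
            by (rule deriv) (rule that)
          show "onorm (f' x y) \<le> g y" if "x \<in> S" for x
            by (rule onorm_bound[OF gnn bound[OF that]])
        qed (use XS S in auto)
        moreover have "norm (f' a y (X i - a)) \<le> g y * norm (X i - a)"
          by (rule bound[OF S(2)])
        ultimately have "norm (f (X i) y - (f a y + f' a y (X i - a))) \<le> 2 * g y * norm (X i - a)"
          using norm_triangle_ineq4[of "f (X i) y - f a y" "f' a y (X i - a)"]
          by (simp add: algebra_simps)
        then show "norm (D i y) \<le> 2 * g y"
          using Xa[of i] by (simp add: D_def divide_simps)
      qed
      show "AE y in M. (\<lambda>i. D i y) \<longlonglongrightarrow> 0"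
      proof (intro always_eventually allI)
        fix y
        have "((\<lambda>x. (1 / norm (x - a)) *\<^sub>R (f x y - (f a y + f' a y (x - a)))) \<longlongrightarrow> 0) (at a within S)"
          using deriv[OF S(2), of y] unfolding has_derivative_within by blast
        then show "(\<lambda>i. D i y) \<longlonglongrightarrow> 0"
          using X unfolding tendsto_at_iff_sequentially D_def by (auto simp: o_def)
      qed
    qed simp
    moreover have "(LINT y|M. D i y) = (1 / norm (X i - a)) *\<^sub>R
        ((LINT y|M. f (X i) y) - ((LINT y|M. f a y) + (LINT y|M. f' a y (X i - a))))" for i
      using int[OF XS, of i] int[OF S(2)] int' unfolding D_def by simp
    ultimately show "((\<lambda>x. (1 / norm (x - a)) *\<^sub>R ((LINT y|M. f x y) - ((LINT y|M. f a y) + (LINT y|M. f' a y (x - a))))) \<circ> X)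
        \<longlonglongrightarrow> 0"
      by (simp add: o_def)
  qed
  ultimately show ?thesis unfolding has_derivative_within by blast
qed

lemma continuous_lebesgue_integral:
  fixes f :: "'a::metric_space \<Rightarrow> 'b \<Rightarrow> 'c::{banach,second_countable_topology}"
  assumes "a \<in> S" and cont: "\<And>y. continuous (at a within S) (\<lambda>x. f x y)"
    and meas: "\<And>x. x \<in> S \<Longrightarrow> f x \<in> borel_measurable M"
    and g: "integrable M g" "\<And>x y. x \<in> S \<Longrightarrow> norm (f x y) \<le> g y"
  shows "continuous (at a within S) (\<lambda>x. LINT y|M. f x y)"
  unfolding continuous_within tendsto_at_iff_sequentially o_def
proof (intro allI impI)
  fix X assume X: "\<forall>i. X i \<in> S - {a}" "X \<longlonglongrightarrow> a"
  show "(\<lambda>i. LINT y|M. f (X i) y) \<longlonglongrightarrow> (LINT y|M. f a y)"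
  proof (rule integral_dominated_convergence[OF _ _ g(1)])
    show "AE y in M. (\<lambda>i. f (X i) y) \<longlonglongrightarrow> f a y"
      using cont X unfolding continuous_within tendsto_at_iff_sequentially o_def by auto
  qed (use assms X in auto)
qed

section \<open>Rapidly decreasing functions\<close>

text \<open>Schwartz decay of order zero: derivatives are left out, since each derivative gets its
  own rapidly decreasing majorant where one is needed.\<close>

definition rapidly_decreasing :: "('a::real_normed_vector \<Rightarrow> 'b::real_normed_vector) \<Rightarrow> bool" where
  "rapidly_decreasing f \<longleftrightarrow> (\<forall>k::nat. \<exists>C. \<forall>x. (1 + norm x) ^ k * norm (f x) \<le> C)"

text \<open>A polynomial factor of degree j is absorbed by using the decay of f with exponent k + j.
  The absolute value of C appears since C carries no sign.\<close>

lemma rapidly_decreasing_dominated: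
  assumes f: "rapidly_decreasing f"
    and le: "\<And>x. norm (F x) \<le> norm (f x) * (C * (1 + norm x) ^ j)"
  shows "rapidly_decreasing F"
  unfolding rapidly_decreasing_def
proof
  fix k
  obtain D where D: "\<And>x. (1 + norm x) ^ (k + j) * norm (f x) \<le> D"
    using f unfolding rapidly_decreasing_def by blast
  have "(1 + norm x) ^ k * norm (F x) \<le> \<bar>C\<bar> * D" for x
  proof -
    have "norm (F x) \<le> norm (f x) * (\<bar>C\<bar> * (1 + norm x) ^ j)"
      using le[of x] by (rule order_trans) (auto intro!: mult_left_mono mult_right_mono)
    then have "(1 + norm x) ^ k * norm (F x) \<le> (1 + norm x) ^ k * (norm (f x) * (\<bar>C\<bar> * (1 + norm x) ^ j))"
      by (intro mult_left_mono) auto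
    also have "\<dots> = \<bar>C\<bar> * ((1 + norm x) ^ (k + j) * norm (f x))"
      by (simp add: power_add)
    also have "\<dots> \<le> \<bar>C\<bar> * D" by (intro mult_left_mono D) auto
    finally show ?thesis .
  qed
  then show "\<exists>C. \<forall>x. (1 + norm x) ^ k * norm (F x) \<le> C" by blast
qed

lemma rapidly_decreasing_le:
  assumes "rapidly_decreasing f" "\<And>x. norm (F x) \<le> norm (f x)"
  shows "rapidly_decreasing F"
  using rapidly_decreasing_dominated[OF assms(1), of F 1 0] assms(2) by simp

lemma rapidly_decreasing_add:
  fixes f g :: "'a::real_normed_vector \<Rightarrow> 'b::real_normed_vector"
  assumes "rapidly_decreasing f" "rapidly_decreasing g"
  shows "rapidly_decreasing (\<lambda>x. f x + g x)"
  unfolding rapidly_decreasing_def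
proof
  fix k
  obtain C D where CD: "\<And>x. (1 + norm x) ^ k * norm (f x) \<le> C" "\<And>x. (1 + norm x) ^ k * norm (g x) \<le> D"
    using assms unfolding rapidly_decreasing_def by metis
  have "(1 + norm x) ^ k * norm (f x + g x) \<le> C + D" for x
    using mult_left_mono[OF norm_triangle_ineq, of "(1 + norm x) ^ k" "f x" "g x"] CD[of x]
    by (simp add: distrib_left)
  then show "\<exists>C. \<forall>x. (1 + norm x) ^ k * norm (f x + g x) \<le> C" by blast
qed

text \<open>Rests on 1 + |(x, y)| \<le> (1 + |x|)(1 + |y|). Used on pairs of states and on pairs of
  phase-space points, where the control integrals live.\<close>

lemma rapidly_decreasing_prod:
  fixes f :: "'a::real_normed_vector \<Rightarrow> real" and g :: "'b::real_normed_vector \<Rightarrow> real"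
  assumes "rapidly_decreasing f" "rapidly_decreasing g"
  shows "rapidly_decreasing (\<lambda>p. f (fst p) * g (snd p))"
  unfolding rapidly_decreasing_def
proof
  fix k
  obtain C D where CD: "\<And>x. (1 + norm x) ^ k * norm (f x) \<le> C" "\<And>y. (1 + norm y) ^ k * norm (g y) \<le> D"
    using assms unfolding rapidly_decreasing_def by metis
  have "(1 + norm p) ^ k * norm (f (fst p) * g (snd p)) \<le> C * D" for p :: "'a \<times> 'b"
  proof -
    have "1 + norm p \<le> (1 + norm (fst p)) * (1 + norm (snd p))"
      using norm_Pair_le[of "fst p" "snd p", simplified]
        mult_nonneg_nonneg[OF norm_ge_zero[of "fst p"] norm_ge_zero[of "snd p"]]
      unfolding distrib_left distrib_right by linarith
    then have "(1 + norm p) ^ k * norm (f (fst p) * g (snd p))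
        \<le> ((1 + norm (fst p)) * (1 + norm (snd p))) ^ k * norm (f (fst p) * g (snd p))"
      by (intro mult_right_mono power_mono) auto
    also have "\<dots> = ((1 + norm (fst p)) ^ k * norm (f (fst p))) * ((1 + norm (snd p)) ^ k * norm (g (snd p)))"
      by (simp only: power_mult_distrib norm_mult mult_ac)
    also have "\<dots> \<le> C * D"
      using order_trans[OF _ CD(1)[of "fst p"]] by (intro mult_mono CD) auto
    finally show ?thesis .
  qed
  then show "\<exists>C. \<forall>p. (1 + norm p) ^ k * norm (f (fst p) * g (snd p)) \<le> C" by blast
qed

section \<open>Integrability and marginals under rapid decay\<close>

text \<open>With n the integer part of |x|, the integrand is at most (1 + n) to the power -(DIM +
  2), and x lies in the ball of radius n + 1, whose volume grows like (n + 1) to the power DIM. The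
  exponent DIM + 2 is chosen so that the series of 1/(1 + n)^2 remains. Summing over balls instead
  of shells only enlarges the majorant.\<close>

lemma integrable_inverse_power_norm:
  "integrable lborel (\<lambda>x::'a::euclidean_space. 1 / (1 + norm x) ^ (DIM('a) + 2))"
proof (rule integrableI_bounded)
  let ?K = "DIM('a) + 2" and ?c = "unit_ball_vol (DIM('a))"
  let ?g = "\<lambda>n x. ennreal (1 / (1 + real n) ^ ?K) * indicator (cball (0::'a) (real n + 1)) x"
  have le: "ennreal (norm (1 / (1 + norm x) ^ ?K)) \<le> (\<Sum>n. ?g n x)" for x :: 'a
  proof -
    define n where "n = nat \<lfloor>norm x\<rfloor>"
    have n: "real n \<le> norm x" "norm x \<le> real n + 1"
      unfolding n_def using norm_ge_zero[of x] by linarith+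
    have "norm (1 / (1 + norm x) ^ ?K) \<le> 1 / (1 + real n) ^ ?K"
      using n(1) by (auto intro!: divide_left_mono power_mono mult_pos_pos simp del: power_add power_Suc add_2_eq_Suc')
    then have "ennreal (norm (1 / (1 + norm x) ^ ?K)) \<le> ?g n x"
      using n(2) by (simp add: ennreal_leI del: power_add)
    also have "\<dots> \<le> (\<Sum>n. ?g n x)"
      using sum_le_suminf[OF summableI, of "{n}" "\<lambda>n. ?g n x"] by (simp del: power_add power_Suc add_2_eq_Suc' sum_mult_indicator)
    finally show ?thesis .
  qed
  have "summable (\<lambda>n. 1 / (1 + real n) ^ 2)"
    using inverse_power_summable[of 2, where 'a=real] summable_Suc_iff[of "\<lambda>n. inverse (real n ^ 2)"]
    by (simp add: field_simps)
  then have "summable (\<lambda>n. ?c * (1 / (1 + real n) ^ 2))"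
    by (rule summable_mult)
  then obtain s where "(\<lambda>n. ?c * (1 / (1 + real n) ^ 2)) sums s"
    by (auto simp: summable_def)
  then have s: "(\<Sum>n. ennreal (?c * (1 / (1 + real n) ^ 2))) = ennreal s"
    by (rule suminf_ennreal_eq[rotated]) simp
  have "(\<integral>\<^sup>+x. ennreal (norm (1 / (1 + norm (x::'a)) ^ ?K)) \<partial>lborel) \<le> (\<integral>\<^sup>+x. (\<Sum>n. ?g n x) \<partial>lborel)"
    by (intro nn_integral_mono le)
  also have "\<dots> = (\<Sum>n. \<integral>\<^sup>+x. ?g n x \<partial>lborel)"
    by (intro nn_integral_suminf borel_measurable_times_ennreal borel_measurable_indicator) auto
  also have "\<dots> = (\<Sum>n. ennreal (?c * (1 / (1 + real n) ^ 2)))"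
  proof (intro suminf_cong)
    fix n
    have "(\<integral>\<^sup>+x. ?g n x \<partial>lborel) = ennreal (1 / (1 + real n) ^ ?K) * ennreal (?c * (real n + 1) ^ DIM('a))"
      by (subst nn_integral_cmult_indicator) (simp_all add: emeasure_cball del: power_add power_Suc)
    also have "\<dots> = ennreal (?c * (1 / (1 + real n) ^ 2))"
      unfolding power_add[of _ _ 2]
      by (subst ennreal_mult[symmetric]) (auto simp: divide_simps add.commute simp del: power_Suc)
    finally show "(\<integral>\<^sup>+x. ?g n x \<partial>lborel) = ennreal (?c * (1 / (1 + real n) ^ 2))" .
  qed
  also have "\<dots> < \<infinity>" unfolding s by simp
  finally show "(\<integral>\<^sup>+x. ennreal (norm (1 / (1 + norm (x::'a)) ^ ?K)) \<partial>lborel) < \<infinity>" .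
qed simp

lemma integrable_inverse_power_norm_dominated:
  fixes f :: "'a::euclidean_space \<Rightarrow> 'b::{banach,second_countable_topology}"
  assumes "f \<in> borel_measurable borel" "\<And>x. (1 + norm x) ^ (DIM('a) + 2) * norm (f x) \<le> C"
  shows "integrable lborel f"
proof (rule Bochner_Integration.integrable_bound)
  show "integrable lborel (\<lambda>x::'a. C * (1 / (1 + norm x) ^ (DIM('a) + 2)))"
    by (intro integrable_mult_right integrable_inverse_power_norm)
  show "AE x in lborel. norm (f x) \<le> norm (C * (1 / (1 + norm x) ^ (DIM('a) + 2)))"
  proof (intro always_eventually allI)
    fix x :: 'a
    have "0 < (1 + norm x) ^ (DIM('a) + 2)" by (simp add: add_pos_nonneg del: power_add power_Suc add_2_eq_Suc')
    then have "norm (f x) \<le> C * (1 / (1 + norm x) ^ (DIM('a) + 2))"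
      using assms(2)[of x] by (simp add: pos_le_divide_eq mult.commute del: power_add power_Suc add_2_eq_Suc')
    also have "\<dots> \<le> norm (C * (1 / (1 + norm x) ^ (DIM('a) + 2)))"
      unfolding real_norm_def by (rule abs_ge_self)
    finally show "norm (f x) \<le> norm (C * (1 / (1 + norm x) ^ (DIM('a) + 2)))" .
  qed
qed (use assms(1) in simp)

lemma integrable_rapidly_decreasing:
  fixes f :: "'a::euclidean_space \<Rightarrow> 'b::{banach,second_countable_topology}"
  assumes "rapidly_decreasing f" "f \<in> borel_measurable borel"
  shows "integrable lborel f"
  using assms integrable_inverse_power_norm_dominated unfolding rapidly_decreasing_def by metis

lemma rapidly_decreasing_section:
  assumes "rapidly_decreasing f"
  shows "rapidly_decreasing (\<lambda>y. f (x, y))"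
  unfolding rapidly_decreasing_def
proof
  fix k
  obtain D where D: "\<And>z. (1 + norm z) ^ k * norm (f z) \<le> D"
    using assms unfolding rapidly_decreasing_def by blast
  have "(1 + norm y) ^ k * norm (f (x, y)) \<le> D" for y
    by (rule order_trans[OF _ D[of "(x, y)"]])
      (auto intro!: mult_right_mono power_mono norm_snd_le)
  then show "\<exists>C. \<forall>y. (1 + norm y) ^ k * norm (f (x, y)) \<le> C" by blast
qed

text \<open>The decay of f with exponent k + DIM + 2 is split: k powers are kept for x, the others
  make the integral over y finite.\<close>

lemma rapidly_decreasing_marginal:
  fixes f :: "'a::euclidean_space \<times> 'b::euclidean_space \<Rightarrow> 'c::{banach,second_countable_topology}"
  assumes f: "rapidly_decreasing f" and cont: "continuous_on UNIV f"
  shows "rapidly_decreasing (\<lambda>x. LINT y|lborel. f (x, y))"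
  unfolding rapidly_decreasing_def
proof
  fix k
  let ?K = "DIM('b) + 2" and ?w = "\<lambda>y::'b. 1 / (1 + norm y) ^ (DIM('b) + 2)"
  obtain D where D: "\<And>z. (1 + norm z) ^ (k + ?K) * norm (f z) \<le> D"
    using f unfolding rapidly_decreasing_def by blast
  have "(1 + norm x) ^ k * norm (LINT y|lborel. f (x, y)) \<le> (LINT y|lborel. D * ?w y)" for x
  proof -
    have "continuous_on UNIV (\<lambda>y. f (x, y))"
      by (rule continuous_on_compose2[OF cont]) (auto intro!: continuous_intros)
    then have int: "integrable lborel (\<lambda>y. f (x, y))"
      by (intro integrable_rapidly_decreasing rapidly_decreasing_section f borel_measurable_continuous_onI)
    have "(1 + norm x) ^ k * norm (LINT y|lborel. f (x, y)) = norm (LINT y|lborel. (1 + norm x) ^ k *\<^sub>R f (x, y))"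
      using add_pos_nonneg[of 1 "norm x"] by (simp add: abs_of_nonneg)
    also have "\<dots> \<le> (LINT y|lborel. norm ((1 + norm x) ^ k *\<^sub>R f (x, y)))"
      by (rule integral_norm_bound)
    also have "\<dots> \<le> (LINT y|lborel. D * ?w y)"
    proof (intro integral_mono integrable_norm integrable_scaleR_right int integrable_mult_right
        integrable_inverse_power_norm)
      fix y
      have "(1 + norm x) ^ k * (1 + norm y) ^ ?K * norm (f (x, y)) \<le> (1 + norm (x, y)) ^ (k + ?K) * norm (f (x, y))"
        unfolding power_add[of _ k ?K]
        by (intro mult_right_mono mult_mono power_mono add_left_mono norm_fst_le norm_snd_le) auto
      also have "\<dots> \<le> D" by (rule D)
      finally have "(1 + norm x) ^ k * norm (f (x, y)) * (1 + norm y) ^ ?K \<le> D" by (simp add: mult_ac)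
      moreover have "0 < (1 + norm y) ^ ?K" by (intro zero_less_power) (simp add: add_pos_nonneg)
      ultimately have "(1 + norm x) ^ k * norm (f (x, y)) \<le> D / (1 + norm y) ^ ?K"
        by (subst pos_le_divide_eq)
      then show "norm ((1 + norm x) ^ k *\<^sub>R f (x, y)) \<le> D * ?w y"
        by (simp add: abs_of_nonneg del: power_add power_Suc add_2_eq_Suc')
    qed
    finally show ?thesis .
  qed
  then show "\<exists>C. \<forall>x. (1 + norm x) ^ k * norm (LINT y|lborel. f (x, y)) \<le> C" by blast
qed

lemma integral_marginal:
  fixes f :: "'a::euclidean_space \<times> 'b::euclidean_space \<Rightarrow> 'c::{banach,second_countable_topology}"
  assumes "rapidly_decreasing f" and "continuous_on UNIV f"
  shows "(LINT z|lborel. f z) = (LINT x|lborel. LINT y|lborel. f (x, y))"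
proof -
  have "integrable (lborel \<Otimes>\<^sub>M lborel) f"
    using integrable_rapidly_decreasing[OF assms(1)] borel_measurable_continuous_onI[OF assms(2)]
    by (simp add: lborel_prod)
  from lborel_pair.integral_fst'[OF this] show ?thesis by (simp add: lborel_prod)
qed

section \<open>Translation, parametric integrals and integration by parts\<close>

text \<open>By translation invariance \<open>s \<mapsto> \<integral> g(x + s v) dx\<close> is constant; differentiate it at \<open>s = 0\<close>.\<close>

lemma integral_derivative_eq_0:
  fixes g :: "'a::euclidean_space \<Rightarrow> 'b::{banach,second_countable_topology}"
    and \<beta> :: "'a \<Rightarrow> real"
  assumes g': "\<And>x. (g has_derivative g' x) (at x)" and cont: "\<And>v. continuous_on UNIV (\<lambda>x. g' x v)"
    and rapid: "rapidly_decreasing g" "rapidly_decreasing \<beta>"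
    and \<beta>: "\<And>x v. norm (g' x v) \<le> \<beta> x * norm v"
  shows "(LINT x|lborel. g' x v) = 0"
proof -
  let ?K = "DIM('a) + 2" and ?S = "{-1..1::real}"
  obtain C where C: "\<And>x. (1 + norm x) ^ ?K * norm (\<beta> x) \<le> C"
    using rapid unfolding rapidly_decreasing_def by blast
  have C0: "0 \<le> C" using order_trans[OF _ C[of 0]] by simp
  \<comment> \<open>The majorant has to hold for all shifts s in [-1, 1] at once. Since 1 + |x|
    \<le> (1 + |v|)(1 + |s v + x|), decay at the shifted point becomes decay at x at the cost of the
    factor \<open>(1 + norm v) ^ ?K\<close>; the remaining |v| comes from the derivative of s
    v.\<close>
  define B where "B = C * norm v * (1 + norm v) ^ ?K"
  have contg: "continuous_on UNIV g"
    using g' by (auto intro!: continuous_at_imp_continuous_on has_derivative_continuous)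
  have intg: "integrable lborel g"
    by (intro integrable_rapidly_decreasing rapid borel_measurable_continuous_onI contg)
  have trans: "(LINT x|lborel. g (s *\<^sub>R v + x)) = (LINT x|lborel. g x)" for s
    by (subst (2) lborel_distr_plus[symmetric, of "s *\<^sub>R v"], subst integral_distr)
      (auto intro!: borel_measurable_continuous_onI contg)
  have der: "((\<lambda>s. LINT x|lborel. g (s *\<^sub>R v + x)) has_derivative
      (\<lambda>d. LINT x|lborel. g' (0 *\<^sub>R v + x) (d *\<^sub>R v))) (at 0 within ?S)"
  proof (rule has_derivative_lebesgue_integral[where f'="\<lambda>s x d. g' (s *\<^sub>R v + x) (d *\<^sub>R v)"])
    show "((\<lambda>s. g (s *\<^sub>R v + x)) has_derivative (\<lambda>d. g' (s *\<^sub>R v + x) (d *\<^sub>R v))) (at s within ?S)" for s x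
      by (rule has_derivative_compose[where g=g, OF _ g']) (auto intro!: derivative_eq_intros)
    show "norm (g' (s *\<^sub>R v + x) (d *\<^sub>R v)) \<le> B * (1 / (1 + norm x) ^ ?K) * norm d"
      if s: "s \<in> ?S" for s x d
    proof -
      have n1: "norm x \<le> norm (s *\<^sub>R v + x) + norm v"
      proof -
        have "norm x \<le> norm (s *\<^sub>R v + x) + norm (s *\<^sub>R v)"
          using norm_triangle_ineq4[of "s *\<^sub>R v + x" "s *\<^sub>R v"] by simp
        moreover have "norm (s *\<^sub>R v) \<le> norm v" using s by (auto intro!: mult_left_le_one_le)
        ultimately show ?thesis by simp
      qed
      have "1 + norm x \<le> (1 + norm v) * (1 + norm (s *\<^sub>R v + x))"
        using n1 mult_nonneg_nonneg[OF norm_ge_zero[of v] norm_ge_zero[of "s *\<^sub>R v + x"]] norm_ge_zero[of "s *\<^sub>R v + x"]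
        unfolding distrib_left distrib_right by linarith
      then have "(1 + norm x) ^ ?K * norm (\<beta> (s *\<^sub>R v + x)) \<le>
          ((1 + norm v) * (1 + norm (s *\<^sub>R v + x))) ^ ?K * norm (\<beta> (s *\<^sub>R v + x))"
        by (intro mult_right_mono power_mono) auto
      also have "\<dots> = (1 + norm v) ^ ?K * ((1 + norm (s *\<^sub>R v + x)) ^ ?K * norm (\<beta> (s *\<^sub>R v + x)))"
        by (simp only: power_mult_distrib mult.assoc)
      also have "\<dots> \<le> (1 + norm v) ^ ?K * C" by (intro mult_left_mono C) auto
      finally have "norm (\<beta> (s *\<^sub>R v + x)) * (1 + norm x) ^ ?K \<le> (1 + norm v) ^ ?K * C"
        by (simp only: mult.commute)
      moreover have "0 < (1 + norm x) ^ ?K" by (intro zero_less_power) (simp add: add_pos_nonneg)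
      ultimately have *: "norm (\<beta> (s *\<^sub>R v + x)) \<le> (1 + norm v) ^ ?K * C / (1 + norm x) ^ ?K"
        by (subst pos_le_divide_eq)
      have "norm (g' (s *\<^sub>R v + x) (d *\<^sub>R v)) \<le> norm (\<beta> (s *\<^sub>R v + x)) * norm (d *\<^sub>R v)"
        by (rule order_trans[OF \<beta>]) (auto intro!: mult_right_mono)
      also have "\<dots> \<le> (1 + norm v) ^ ?K * C / (1 + norm x) ^ ?K * norm (d *\<^sub>R v)"
        by (intro mult_right_mono *) auto
      finally show ?thesis by (simp add: B_def mult_ac del: power_add power_Suc add_2_eq_Suc')
    qed
    show "integrable lborel (\<lambda>x. g (s *\<^sub>R v + x))" for s
      using integrable_distr[of "\<lambda>x. s *\<^sub>R v + x" lborel lborel g] intg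
      by (simp add: lborel_distr_plus[unfolded comp_def] distr_cong[of lborel lborel lborel borel])
    show "integrable lborel (\<lambda>x::'a. B * (1 / (1 + norm x) ^ ?K))"
      by (intro integrable_mult_right integrable_inverse_power_norm)
    show "(\<lambda>x. g' (0 *\<^sub>R v + x) (d *\<^sub>R v)) \<in> borel_measurable lborel" for d
      using borel_measurable_continuous_onI[OF cont] by simp
  qed auto
  have "((\<lambda>s. LINT x|lborel. g (s *\<^sub>R v + x)) has_derivative
      (\<lambda>d. LINT x|lborel. g' (0 *\<^sub>R v + x) (d *\<^sub>R v))) (at 0)"
    using der at_within_interior[of 0 ?S] by simp
  moreover have "((\<lambda>s. LINT x|lborel. g (s *\<^sub>R v + x)) has_derivative (\<lambda>d. 0)) (at 0)"
    unfolding trans by simp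
  ultimately have "(\<lambda>d. LINT x|lborel. g' (0 *\<^sub>R v + x) (d *\<^sub>R v)) = (\<lambda>d::real. 0)"
    by (rule has_derivative_unique)
  from fun_cong[OF this, of 1] show ?thesis by simp
qed

text \<open>H and \<open>H'\<close> grow polynomially in both variables, so no majorant is uniform
  in x. On the unit ball around a, however, 1 + |x| + |y| \<le> (2 + |a|)(1 + |y|), and the decay of
  the weight \<phi> pays for the power of y. Differentiability and continuity are local, so this
  suffices. The weight will be the state density or the norm of the momentum.\<close>

lemma parametric_integral:
  fixes H :: "'a::euclidean_space \<Rightarrow> 'b::euclidean_space \<Rightarrow> 'c::{banach,second_countable_topology}"
    and \<phi> :: "'b \<Rightarrow> real"
  assumes H': "\<And>x y. ((\<lambda>x. H x y) has_derivative H' x y) (at x)"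
    and contH: "\<And>x. continuous_on UNIV (H x)"
    and contH': "\<And>v. continuous_on UNIV (\<lambda>(x, y). H' x y v)"
    and \<phi>: "rapidly_decreasing \<phi>" "continuous_on UNIV \<phi>"
    and le: "\<And>x y. norm (H x y) \<le> \<bar>\<phi> y\<bar> * (C * (1 + norm x + norm y) ^ k)"
    and le': "\<And>x y v. norm (H' x y v) \<le> \<bar>\<phi> y\<bar> * (C * (1 + norm x + norm y) ^ k) * norm v"
  shows "integrable lborel (H x)" "integrable lborel (\<lambda>y. H' x y v)"
    and "((\<lambda>x. LINT y|lborel. H x y) has_derivative (\<lambda>v. LINT y|lborel. H' x y v)) (at x)"
    and "continuous_on UNIV (\<lambda>x. LINT y|lborel. H' x y v)"
proof -
  define g where "g = (\<lambda>(a::'a) y. \<bar>\<phi> y\<bar> * (\<bar>C\<bar> * (2 + norm a) ^ k * (1 + norm y) ^ k))"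
  have intg: "integrable lborel (g a)" for a
  proof (intro integrable_rapidly_decreasing borel_measurable_continuous_onI)
    show "rapidly_decreasing (g a)"
      by (rule rapidly_decreasing_dominated[OF \<phi>(1), of _ "\<bar>C\<bar> * (2 + norm a) ^ k" k])
        (auto simp: g_def abs_mult)
    show "continuous_on UNIV (g a)"
      unfolding g_def by (intro continuous_intros \<phi>(2))
  qed
  have g: "\<bar>\<phi> y\<bar> * (C * (1 + norm x + norm y) ^ k) \<le> g a y" if "x \<in> ball a 1" for a x y
  proof -
    have "norm x \<le> norm a + 1"
      using that norm_triangle_ineq3[of a x] by (simp add: dist_norm norm_minus_commute)
    then have "1 + norm x + norm y \<le> (2 + norm a) * (1 + norm y)"
      using mult_nonneg_nonneg[OF norm_ge_zero[of a] norm_ge_zero[of y]] norm_ge_zero[of y]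
      unfolding distrib_left distrib_right by linarith
    then have "(1 + norm x + norm y) ^ k \<le> (2 + norm a) ^ k * (1 + norm y) ^ k"
      unfolding power_mult_distrib[symmetric] by (intro power_mono) auto
    then have "C * (1 + norm x + norm y) ^ k \<le> \<bar>C\<bar> * ((2 + norm a) ^ k * (1 + norm y) ^ k)"
      by (intro mult_mono) auto
    then show ?thesis
      unfolding g_def by (intro mult_left_mono) (auto simp: mult.assoc)
  qed
  have g0: "norm (g a y) = g a y" for a y by (simp add: g_def)
  have contH'x: "continuous_on UNIV (\<lambda>y. H' x y v)" "continuous_on UNIV (\<lambda>x. H' x y v)" for x y v
  proof -
    have "continuous_on UNIV (\<lambda>y. (x, y))" "continuous_on UNIV (\<lambda>x. (x, y))"
      by (intro continuous_on_Pair continuous_on_const continuous_on_id)+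
    from this[THEN continuous_on_compose2[OF contH'[of v]]]
    show "continuous_on UNIV (\<lambda>y. H' x y v)" "continuous_on UNIV (\<lambda>x. H' x y v)"
      by simp_all
  qed
  have int: "integrable lborel (H x)" for x
  proof (rule Bochner_Integration.integrable_bound[OF intg[of x]])
    show "AE y in lborel. norm (H x y) \<le> norm (g x y)"
      unfolding g0 by (intro always_eventually allI order_trans[OF le g]) simp
  qed (use borel_measurable_continuous_onI[OF contH] in simp)
  show "integrable lborel (H x)" by (rule int)
  have le'g: "norm (H' x y v) \<le> g a y * norm v" if "x \<in> ball a 1" for a x y v
    using order_trans[OF le' mult_right_mono[OF g[OF that]]] by simp
  show "integrable lborel (\<lambda>y. H' x y v)"
  proof (rule Bochner_Integration.integrable_bound[OF integrable_mult_left[OF intg[of x], of "norm v"]])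
    show "AE y in lborel. norm (H' x y v) \<le> norm (g x y * norm v)"
      using le'g[of x x] g0[of x] by (intro always_eventually allI) (simp add: abs_mult)
  qed (use borel_measurable_continuous_onI[OF contH'x(1)] in simp)
  have "((\<lambda>x. LINT y|lborel. H x y) has_derivative (\<lambda>v. LINT y|lborel. H' x y v)) (at x within ball x 1)"
  proof (rule has_derivative_lebesgue_integral[OF convex_ball, where g="g x"])
    show "((\<lambda>x. H x y) has_derivative H' z y) (at z within ball x 1)" for z y
      by (rule has_derivative_at_withinI[OF H'])
    show "(\<lambda>y. H' x y v) \<in> borel_measurable lborel" for v
      using borel_measurable_continuous_onI[OF contH'x(1)] by simp
  qed (simp, rule le'g, assumption, rule int, rule intg)
  then show "((\<lambda>x. LINT y|lborel. H x y) has_derivative (\<lambda>v. LINT y|lborel. H' x y v)) (at x)"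
    by (simp add: at_within_open[of x "ball x 1"])
  show "continuous_on UNIV (\<lambda>x. LINT y|lborel. H' x y v)"
  proof (intro continuous_at_imp_continuous_on ballI)
    fix a
    have "continuous (at a within ball a 1) (\<lambda>x. LINT y|lborel. H' x y v)"
    proof (rule continuous_lebesgue_integral)
      show "continuous (at a within ball a 1) (\<lambda>x. H' x y v)" for y
        by (rule continuous_on_imp_continuous_within[OF contH'x(2)]) auto
      show "integrable lborel (\<lambda>y. g a y * norm v)" using intg by simp
      show "(\<lambda>y. H' x y v) \<in> borel_measurable lborel" for x
        using borel_measurable_continuous_onI[OF contH'x(1)] by simp
    qed (simp, rule le'g, assumption)
    then show "isCont (\<lambda>x. LINT y|lborel. H' x y v) a"
      by (simp add: at_within_open[of a "ball a 1"])
  qed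
qed

text \<open>Integration by parts against 1 and against x, with no boundary terms. Each is the
  vanishing integral of a derivative: of the component \<Phi>_i in direction i, and of the vector
  function \<Phi>_i x in direction i.\<close>

lemma integral_divg:
  fixes \<Phi> :: "real^'n \<Rightarrow> real^'n" and \<beta> :: "real^'n \<Rightarrow> real"
  assumes \<Phi>': "\<And>x. (\<Phi> has_derivative \<Phi>' x) (at x)" and cont: "\<And>v. continuous_on UNIV (\<lambda>x. \<Phi>' x v)"
    and rapid: "rapidly_decreasing \<Phi>" "rapidly_decreasing \<beta>"
    and \<beta>: "\<And>x v. norm (\<Phi>' x v) \<le> \<beta> x * norm v"
  shows "integrable lborel (divg \<Phi>)" "(LINT x|lborel. divg \<Phi> x) = 0"
    and "integrable lborel (\<lambda>x. divg \<Phi> x *\<^sub>R x)" "(LINT x|lborel. divg \<Phi> x *\<^sub>R x) = - (LINT x|lborel. \<Phi> x)"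
proof -
  define d where "d = (\<lambda>i x. \<Phi>' x (axis i 1) $ i)"
  have divg: "divg \<Phi> x = (\<Sum>i\<in>UNIV. d i x)" for x
    unfolding d_def by (rule divg_eq[OF \<Phi>'])
  have cont\<Phi>: "continuous_on UNIV \<Phi>"
    using \<Phi>' by (auto intro!: continuous_at_imp_continuous_on has_derivative_continuous)
  have contd: "continuous_on UNIV (d i)" for i
    unfolding d_def by (intro continuous_intros cont)
  have d_le: "norm (\<Phi>' x v $ i) \<le> norm (\<beta> x) * norm v" for x v i
  proof -
    have "norm (\<Phi>' x v $ i) \<le> norm (\<Phi>' x v)" using component_le_norm_cart[of "\<Phi>' x v" i] by simp
    also have "\<dots> \<le> \<beta> x * norm v" by (rule \<beta>)
    also have "\<dots> \<le> norm (\<beta> x) * norm v" by (intro mult_right_mono) auto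
    finally show ?thesis .
  qed
  have \<Phi>_le: "norm (\<Phi> x $ i) \<le> norm (\<Phi> x)" for x i
    using component_le_norm_cart[of "\<Phi> x" i] by simp
  have rapidd: "rapidly_decreasing (d i)" for i
    by (rule rapidly_decreasing_le[OF rapid(2)]) (use d_le[of _ "axis i 1" i] in \<open>simp add: d_def\<close>)
  have intd: "integrable lborel (d i)" for i
    by (intro integrable_rapidly_decreasing rapidd borel_measurable_continuous_onI contd)
  have rapiddx: "rapidly_decreasing (\<lambda>x. d i x *\<^sub>R x)" for i
    by (rule rapidly_decreasing_dominated[OF rapidd[of i], of _ 1 1]) (auto intro!: mult_left_mono)
  have intdx: "integrable lborel (\<lambda>x. d i x *\<^sub>R x)" for i
    by (intro integrable_rapidly_decreasing rapiddx borel_measurable_continuous_onI continuous_intros contd)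
  have "integrable lborel \<Phi>"
    by (intro integrable_rapidly_decreasing rapid borel_measurable_continuous_onI cont\<Phi>)
  then have int\<Phi>: "integrable lborel (\<lambda>x. (\<Phi> x $ i) *\<^sub>R axis i (1::real))" for i
    by (intro integrable_scaleR_left integrable_bounded_linear[OF bounded_linear_vec_nth])
  show "integrable lborel (divg \<Phi>)" "integrable lborel (\<lambda>x. divg \<Phi> x *\<^sub>R x)"
    unfolding divg[abs_def] scaleR_sum_left by (intro Bochner_Integration.integrable_sum intd intdx)+
  have "(LINT x|lborel. d i x) = 0" for i
    unfolding d_def
    by (rule integral_derivative_eq_0[where g="\<lambda>x. \<Phi> x $ i" and g'="\<lambda>x v. \<Phi>' x v $ i" and \<beta>="\<lambda>x. norm (\<beta> x)"])
      (intro bounded_linear.has_derivative[OF bounded_linear_vec_nth] \<Phi>' continuous_intros cont d_le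
        rapidly_decreasing_le[OF rapid(1)] \<Phi>_le rapidly_decreasing_le[OF rapid(2)] | simp)+
  then show "(LINT x|lborel. divg \<Phi> x) = 0"
    unfolding divg[abs_def] using intd by simp
  \<comment> \<open>The derivative of \<Phi>_i x in direction i has two parts, the i-th summand of
    the divergence times x and \<Phi>_i times the unit vector i; summed over i, the second part
    rebuilds \<Phi>.\<close>
  have i: "(LINT x|lborel. d i x *\<^sub>R x + (\<Phi> x $ i) *\<^sub>R axis i 1) = 0" for i
    unfolding d_def
  proof (rule integral_derivative_eq_0[where g="\<lambda>x. (\<Phi> x $ i) *\<^sub>R x" and g'="\<lambda>x v. (\<Phi>' x v $ i) *\<^sub>R x + (\<Phi> x $ i) *\<^sub>R v"
      and \<beta>="\<lambda>x. norm (\<beta> x) * norm x + norm (\<Phi> x)"])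
    show "((\<lambda>x. (\<Phi> x $ i) *\<^sub>R x) has_derivative (\<lambda>v. (\<Phi>' x v $ i) *\<^sub>R x + (\<Phi> x $ i) *\<^sub>R v)) (at x)" for x
      by (auto intro!: derivative_eq_intros bounded_linear.has_derivative[OF bounded_linear_vec_nth \<Phi>'])
    show "continuous_on UNIV (\<lambda>x. (\<Phi>' x v $ i) *\<^sub>R x + (\<Phi> x $ i) *\<^sub>R v)" for v
      by (intro continuous_intros cont cont\<Phi>)
    show "rapidly_decreasing (\<lambda>x. (\<Phi> x $ i) *\<^sub>R x)"
      by (rule rapidly_decreasing_dominated[OF rapid(1), of _ 1 1])
        (auto intro!: mult_mono \<Phi>_le[simplified])
    show "norm ((\<Phi>' x v $ i) *\<^sub>R x + (\<Phi> x $ i) *\<^sub>R v) \<le> (norm (\<beta> x) * norm x + norm (\<Phi> x)) * norm v" for x v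
    proof -
      have "norm ((\<Phi>' x v $ i) *\<^sub>R x) \<le> norm (\<beta> x) * norm v * norm x"
        using mult_right_mono[OF d_le[of x v i], of "norm x"] by simp
      moreover have "norm ((\<Phi> x $ i) *\<^sub>R v) \<le> norm (\<Phi> x) * norm v"
        using mult_right_mono[OF \<Phi>_le[of x i], of "norm v"] by simp
      ultimately show ?thesis
        by (intro order_trans[OF norm_triangle_ineq]) (simp add: algebra_simps)
    qed
    have "rapidly_decreasing (\<lambda>x. norm (\<beta> x) * norm x)"
      by (rule rapidly_decreasing_dominated[OF rapid(2), of _ 1 1]) (auto intro!: mult_left_mono)
    then show "rapidly_decreasing (\<lambda>x. norm (\<beta> x) * norm x + norm (\<Phi> x))"
      by (intro rapidly_decreasing_add rapidly_decreasing_le[OF rapid(1), of "\<lambda>x. norm (\<Phi> x)"]) auto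
  qed
  have "(LINT x|lborel. divg \<Phi> x *\<^sub>R x + \<Phi> x) = (LINT x|lborel. (\<Sum>i\<in>UNIV. d i x *\<^sub>R x + (\<Phi> x $ i) *\<^sub>R axis i 1))"
  proof (rule Bochner_Integration.integral_cong)
    show "divg \<Phi> x *\<^sub>R x + \<Phi> x = (\<Sum>i\<in>UNIV. d i x *\<^sub>R x + (\<Phi> x $ i) *\<^sub>R axis i 1)" for x
      using basis_expansion[of "\<Phi> x"]
      by (simp add: divg sum.distrib scaleR_sum_left scalar_mult_eq_scaleR)
  qed simp
  also have "\<dots> = (\<Sum>i\<in>UNIV. LINT x|lborel. d i x *\<^sub>R x + (\<Phi> x $ i) *\<^sub>R axis i 1)"
    by (rule Bochner_Integration.integral_sum) (intro Bochner_Integration.integrable_add intdx int\<Phi>)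
  also have "\<dots> = 0" by (simp add: i)
  finally have "(LINT x|lborel. divg \<Phi> x *\<^sub>R x + \<Phi> x) = 0" .
  then show "(LINT x|lborel. divg \<Phi> x *\<^sub>R x) = - (LINT x|lborel. \<Phi> x)"
    using \<open>integrable lborel \<Phi>\<close> \<open>integrable lborel (\<lambda>x. divg \<Phi> x *\<^sub>R x)\<close>
    by (simp add: eq_neg_iff_add_eq_0)
qed

section \<open>Marginals of a phase-space density\<close>

locale density_path =
  fixes T :: real and h :: "real \<Rightarrow> real^'n \<Rightarrow> real^'n \<Rightarrow> real"
    and h' :: "real \<times> (real^'n) \<times> (real^'n) \<Rightarrow> (real \<times> (real^'n) \<times> (real^'n)) \<Rightarrow>\<^sub>L real"
  assumes T: "0 < T"
    and h': "\<And>p. p \<in> {0..T} \<times> UNIV \<Longrightarrow>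
      ((\<lambda>(t, x, l). h t x l) has_derivative blinfun_apply (h' p)) (at p within {0..T} \<times> UNIV)"
    and cont_h': "continuous_on ({0..T} \<times> UNIV) h'"
    and decay: "\<And>k. \<exists>C. \<forall>t\<in>{0..T}. \<forall>x l.
      (1 + norm x + norm l) ^ k * (\<bar>h t x l\<bar> + norm (h' (t, x, l))) \<le> C"
begin

definition state_density :: "real \<Rightarrow> real^'n \<Rightarrow> real" where
  "state_density t x = (LINT l|lborel. h t x l)"

definition momentum :: "real \<Rightarrow> real^'n \<Rightarrow> real^'n" where
  "momentum t x = (LINT l|lborel. h t x l *\<^sub>R l)"

text \<open>The joint derivative in (t, x), kept as one linear form, so that time derivative plus
  transport is a single evaluation at (1, velocity).\<close>

definition state_density' :: "real \<Rightarrow> real^'n \<Rightarrow> real \<times> (real^'n) \<Rightarrow> real" where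
  "state_density' t x v = (LINT l|lborel. h' (t, x, l) (fst v, snd v, 0))"

definition momentum' :: "real \<Rightarrow> real^'n \<Rightarrow> real \<times> (real^'n) \<Rightarrow> real^'n" where
  "momentum' t x v = (LINT l|lborel. h' (t, x, l) (fst v, snd v, 0) *\<^sub>R l)"

lemma h_partials:
  assumes t: "t \<in> {0..T}"
  shows "vector_derivative (\<lambda>s. h s x l) (at t within {0..T}) = h' (t, x, l) (1, 0, 0)"
    and "((\<lambda>y. h t y l) has_derivative (\<lambda>v. h' (t, x, l) (0, v, 0))) (at x)"
    and "((\<lambda>\<mu>. h t x \<mu>) has_derivative (\<lambda>v. h' (t, x, l) (0, 0, v))) (at l)"
proof -
  note p = slab_partial_derivatives[OF h' t, of "(x, l)"]
  show "vector_derivative (\<lambda>s. h s x l) (at t within {0..T}) = h' (t, x, l) (1, 0, 0)"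
    using p(1) t T by (intro vector_derivative_within_closed_interval) (simp_all add: zero_prod_def)
  have p2: "((\<lambda>z. h t (fst z) (snd z)) has_derivative (\<lambda>v. h' (t, x, l) (0, v))) (at (x, l))"
    using p(2) t by (simp add: case_prod_unfold)
  have "((\<lambda>y. (y, l)) has_derivative (\<lambda>v. (v, 0))) (at x)" "((\<lambda>\<mu>. (x, \<mu>)) has_derivative (\<lambda>v. (0, v))) (at l)"
    by (auto intro!: derivative_eq_intros)
  from this[THEN has_derivative_compose, of "\<lambda>z. h t (fst z) (snd z)" "\<lambda>v. h' (t, x, l) (0, v)"] p2
  show "((\<lambda>y. h t y l) has_derivative (\<lambda>v. h' (t, x, l) (0, v, 0))) (at x)"
    and "((\<lambda>\<mu>. h t x \<mu>) has_derivative (\<lambda>v. h' (t, x, l) (0, 0, v))) (at l)"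
    by simp_all
qed

lemma continuous_h:
  assumes "t \<in> {0..T}"
  shows "continuous_on UNIV (\<lambda>z. h t (fst z) (snd z))"
proof -
  have "continuous_on ({0..T} \<times> UNIV) (\<lambda>(t, x, l). h t x l)"
    using h' by (auto simp: continuous_on_eq_continuous_within intro!: has_derivative_continuous)
  moreover have "continuous_on UNIV (\<lambda>z. (t, z))"
    by (intro continuous_on_Pair continuous_on_const continuous_on_id)
  ultimately have "continuous_on UNIV (\<lambda>z. case (t, z) of (t, x, l) \<Rightarrow> h t x l)"
    by (rule continuous_on_compose2) (use assms in auto)
  then show ?thesis by (simp add: case_prod_unfold)
qed

lemma continuous_h':
  assumes "t \<in> {0..T}"
  shows "continuous_on UNIV (\<lambda>z. h' (t, fst z, snd z) v)"
proof -
  have "continuous_on UNIV (\<lambda>z. (t, fst z, snd z))"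
    by (intro continuous_intros)
  then have "continuous_on UNIV (\<lambda>z. h' (t, fst z, snd z))"
    by (rule continuous_on_compose2[OF cont_h']) (use assms in auto)
  then show ?thesis by (intro continuous_intros)
qed

lemma continuous_section_h:
  assumes "t \<in> {0..T}"
  shows "continuous_on UNIV (h t x)" "continuous_on UNIV (\<lambda>l. h' (t, x, l) v)"
proof -
  have "continuous_on UNIV (\<lambda>l. (x, l))"
    by (intro continuous_on_Pair continuous_on_const continuous_on_id)
  from continuous_on_compose2[OF continuous_h[OF assms] this] continuous_on_compose2[OF continuous_h'[OF assms] this]
  show "continuous_on UNIV (h t x)" "continuous_on UNIV (\<lambda>l. h' (t, x, l) v)"
    by simp_all
qed

lemma rapidly_decreasing_jet:
  assumes "t \<in> {0..T}"
  shows "rapidly_decreasing (\<lambda>z. \<bar>h t (fst z) (snd z)\<bar> + norm (h' (t, fst z, snd z)))"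
  unfolding rapidly_decreasing_def
proof
  fix k
  obtain C where C: "\<And>x l. (1 + norm x + norm l) ^ k * (\<bar>h t x l\<bar> + norm (h' (t, x, l))) \<le> C"
    using decay[of k] assms by blast
  have "(1 + norm z) ^ k * norm (\<bar>h t (fst z) (snd z)\<bar> + norm (h' (t, fst z, snd z))) \<le> C" for z
  proof -
    have "1 + norm z \<le> 1 + norm (fst z) + norm (snd z)"
      using norm_Pair_le[of "fst z" "snd z"] by simp
    then have "(1 + norm z) ^ k * (\<bar>h t (fst z) (snd z)\<bar> + norm (h' (t, fst z, snd z)))
        \<le> (1 + norm (fst z) + norm (snd z)) ^ k * (\<bar>h t (fst z) (snd z)\<bar> + norm (h' (t, fst z, snd z)))"
      by (intro mult_right_mono power_mono) auto
    with C[of "fst z" "snd z"] show ?thesis by simp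
  qed
  then show "\<exists>C. \<forall>z. (1 + norm z) ^ k * norm (\<bar>h t (fst z) (snd z)\<bar> + norm (h' (t, fst z, snd z))) \<le> C"
    by blast
qed

lemma rapidly_decreasing_h: "t \<in> {0..T} \<Longrightarrow> rapidly_decreasing (\<lambda>z. h t (fst z) (snd z))"
  by (rule rapidly_decreasing_le[OF rapidly_decreasing_jet]) auto

lemma rapidly_decreasing_section_jet:
  "t \<in> {0..T} \<Longrightarrow> rapidly_decreasing (\<lambda>l. \<bar>h t x l\<bar> + norm (h' (t, x, l)))"
  using rapidly_decreasing_section[OF rapidly_decreasing_jet, of t x] by simp

lemma rapidly_decreasing_section_h: "t \<in> {0..T} \<Longrightarrow> rapidly_decreasing (h t x)"
  by (rule rapidly_decreasing_le[OF rapidly_decreasing_section_jet[of t x]]) auto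

text \<open>The summand |h| is added so that one rapidly decreasing majorant controls both h and its
  derivative.\<close>

lemma norm_h'_le: "norm (h' (t, x, l) v) \<le> (\<bar>h t x l\<bar> + norm (h' (t, x, l))) * norm v"
  by (rule order_trans[OF norm_blinfun]) (auto intro!: mult_right_mono)

section \<open>Moments in \<lambda> and their derivatives\<close>

text \<open>The growth bound on W admits exactly what is needed later: W = 1 for the state density
  and W = identity for the momentum.\<close>

lemma integrable_weighted:
  fixes W :: "real^'n \<Rightarrow> 'c::euclidean_space"
  assumes t: "t \<in> {0..T}" and W: "continuous_on UNIV W" "\<And>l. norm (W l) \<le> 1 + norm l"
  shows "integrable lborel (\<lambda>l. h t x l *\<^sub>R W l)" "integrable lborel (\<lambda>l. h' (t, x, l) v *\<^sub>R W l)"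
proof -
  have le: "norm (h' (t, x, l) v *\<^sub>R W l) \<le> norm (\<bar>h t x l\<bar> + norm (h' (t, x, l))) * (norm v * (1 + norm l) ^ 1)" for l
    using mult_mono[OF norm_h'_le W(2), of t x l v l] by (simp add: mult_ac)
  show "integrable lborel (\<lambda>l. h' (t, x, l) v *\<^sub>R W l)"
    by (intro integrable_rapidly_decreasing borel_measurable_continuous_onI continuous_intros
        continuous_section_h t W rapidly_decreasing_dominated[OF rapidly_decreasing_section_jet[OF t] le])
  have le: "norm (h t x l *\<^sub>R W l) \<le> norm (h t x l) * (1 * (1 + norm l) ^ 1)" for l
    using W(2) by (auto intro!: mult_left_mono)
  show "integrable lborel (\<lambda>l. h t x l *\<^sub>R W l)"
    by (intro integrable_rapidly_decreasing borel_measurable_continuous_onI continuous_intros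
        continuous_section_h t W rapidly_decreasing_dominated[OF rapidly_decreasing_section_h[OF t] le])
qed

lemma weighted_has_derivative:
  fixes W :: "real^'n \<Rightarrow> 'c::euclidean_space"
  assumes t: "t \<in> {0..T}" and W: "continuous_on UNIV W" "\<And>l. norm (W l) \<le> 1 + norm l"
  shows "((\<lambda>(t, x). LINT l|lborel. h t x l *\<^sub>R W l) has_derivative
    (\<lambda>v. LINT l|lborel. h' (t, x, l) (fst v, snd v, 0) *\<^sub>R W l)) (at (t, x) within {0..T} \<times> UNIV)"
proof -
  \<comment> \<open>\<open>?K\<close> powers make the majorant integrable in l and one more pays for
    W. The constant from \<open>decay\<close> is uniform in t and x, so one majorant serves the
    whole slab.\<close>
  let ?K = "DIM(real^'n) + 2"
  obtain C where C: "\<And>t x l. t \<in> {0..T} \<Longrightarrow> (1 + norm x + norm l) ^ (?K + 1) * (\<bar>h t x l\<bar> + norm (h' (t, x, l))) \<le> C"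
    using decay[of "?K + 1"] by blast
  have C': "(\<bar>h t x l\<bar> + norm (h' (t, x, l))) * (1 + norm l) \<le> C * (1 / (1 + norm l) ^ ?K)"
    if "t \<in> {0..T}" for t x l
  proof -
    have "(1 + norm l) ^ (?K + 1) * (\<bar>h t x l\<bar> + norm (h' (t, x, l)))
        \<le> (1 + norm x + norm l) ^ (?K + 1) * (\<bar>h t x l\<bar> + norm (h' (t, x, l)))"
      by (intro mult_right_mono power_mono) auto
    also have "\<dots> \<le> C" by (rule C[OF that])
    finally have "(\<bar>h t x l\<bar> + norm (h' (t, x, l))) * (1 + norm l) * (1 + norm l) ^ ?K \<le> C"
      unfolding power_add power_one_right by (simp only: mult_ac)
    moreover have "0 < (1 + norm l) ^ ?K" by (intro zero_less_power) (simp add: add_pos_nonneg)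
    ultimately show ?thesis
      unfolding times_divide_eq_right mult_1_right by (subst pos_le_divide_eq)
  qed
  have "((\<lambda>p. LINT l|lborel. h (fst p) (snd p) l *\<^sub>R W l) has_derivative
    (\<lambda>v. LINT l|lborel. h' (fst (t, x), snd (t, x), l) (fst v, snd v, 0) *\<^sub>R W l)) (at (t, x) within {0..T} \<times> UNIV)"
  proof (rule has_derivative_lebesgue_integral[where g="\<lambda>l. C * (1 / (1 + norm l) ^ ?K)"
      and f'="\<lambda>p l v. h' (fst p, snd p, l) (fst v, snd v, 0) *\<^sub>R W l"])
    show "convex ({0..T} \<times> (UNIV :: (real^'n) set))" by (intro convex_Times convex_UNIV) simp
    fix p :: "real \<times> (real^'n)" and l :: "real^'n" assume p: "p \<in> {0..T} \<times> UNIV"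
    have "((\<lambda>p. (fst p, snd p, l)) has_derivative (\<lambda>v. (fst v, snd v, 0))) (at p within {0..T} \<times> UNIV)"
      by (intro has_derivative_Pair has_derivative_fst has_derivative_snd has_derivative_ident has_derivative_const)
    from has_derivative_in_compose2[OF h' _ p this]
    have "((\<lambda>p. h (fst p) (snd p) l) has_derivative (\<lambda>v. h' (fst p, snd p, l) (fst v, snd v, 0))) (at p within {0..T} \<times> UNIV)"
      by (simp add: image_subset_iff)
    then show "((\<lambda>p. h (fst p) (snd p) l *\<^sub>R W l) has_derivative (\<lambda>v. h' (fst p, snd p, l) (fst v, snd v, 0) *\<^sub>R W l)) (at p within {0..T} \<times> UNIV)"
      by (rule has_derivative_scaleR_left)
    show "norm (h' (fst p, snd p, l) (fst v, snd v, 0) *\<^sub>R W l) \<le> C * (1 / (1 + norm l) ^ ?K) * norm v" for v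
    proof -
      have n: "norm (fst v, snd v, 0 :: real^'n) = norm v" by (simp add: norm_Pair norm_prod_def)
      have "norm (h' (fst p, snd p, l) (fst v, snd v, 0) *\<^sub>R W l)
          \<le> (\<bar>h (fst p) (snd p) l\<bar> + norm (h' (fst p, snd p, l))) * norm v * (1 + norm l)"
        unfolding norm_scaleR using norm_h'_le[of "fst p" "snd p" l "(fst v, snd v, 0)"]
        by (intro mult_mono W(2)) (auto simp: n)
      also have "\<dots> = ((\<bar>h (fst p) (snd p) l\<bar> + norm (h' (fst p, snd p, l))) * (1 + norm l)) * norm v"
        by (simp only: mult_ac)
      also have "\<dots> \<le> C * (1 / (1 + norm l) ^ ?K) * norm v"
        using p by (intro mult_right_mono C') auto
      finally show ?thesis .
    qed
    show "integrable lborel (\<lambda>l. h (fst p) (snd p) l *\<^sub>R W l)"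
      using p by (intro integrable_weighted W) auto
  next
    show "integrable lborel (\<lambda>l::real^'n. C * (1 / (1 + norm l) ^ ?K))"
      by (intro integrable_mult_right integrable_inverse_power_norm)
    show "(\<lambda>l. h' (fst (t, x), snd (t, x), l) (fst v, snd v, 0) *\<^sub>R W l) \<in> borel_measurable lborel" for v
      using integrable_weighted(2)[OF t W, of x "(fst v, snd v, 0)"] by (simp add: borel_measurable_integrable)
  qed (use t in auto)
  then show ?thesis by (simp add: case_prod_unfold)
qed

lemma state_density_has_derivative:
  "t \<in> {0..T} \<Longrightarrow> ((\<lambda>(t, x). state_density t x) has_derivative state_density' t x) (at (t, x) within {0..T} \<times> UNIV)"
  using weighted_has_derivative[of t "\<lambda>_. 1::real" x] by (simp add: state_density_def state_density'_def[abs_def])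

lemma momentum_has_derivative:
  "t \<in> {0..T} \<Longrightarrow> ((\<lambda>(t, x). momentum t x) has_derivative momentum' t x) (at (t, x) within {0..T} \<times> UNIV)"
  using weighted_has_derivative[of t "\<lambda>l. l" x] by (simp add: momentum_def momentum'_def[abs_def])

lemma
  assumes t: "t \<in> {0..T}"
  shows rapidly_decreasing_density: "rapidly_decreasing (state_density t)"
    and rapidly_decreasing_momentum: "rapidly_decreasing (momentum t)"
proof -
  show "rapidly_decreasing (state_density t)"
    using rapidly_decreasing_marginal[OF rapidly_decreasing_h[OF t] continuous_h[OF t]]
    by (simp add: state_density_def[abs_def])
  have "rapidly_decreasing (\<lambda>z. h t (fst z) (snd z) *\<^sub>R snd z)"
  proof (rule rapidly_decreasing_dominated[OF rapidly_decreasing_h[OF t], of _ 1 1])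
    show "norm (h t (fst z) (snd z) *\<^sub>R snd z) \<le> norm (h t (fst z) (snd z)) * (1 * (1 + norm z) ^ 1)" for z
      using norm_snd_le[of "snd z" "fst z"] by (auto intro!: mult_left_mono)
  qed
  from rapidly_decreasing_marginal[OF this] show "rapidly_decreasing (momentum t)"
    using t by (simp add: momentum_def[abs_def] continuous_h continuous_on_scaleR continuous_on_snd continuous_on_id)
qed

lemma
  assumes t: "t \<in> {0..T}"
  shows continuous_density: "continuous_on UNIV (state_density t)"
    and continuous_momentum: "continuous_on UNIV (momentum t)"
  using slab_partial_derivatives(2)[OF state_density_has_derivative t] slab_partial_derivatives(2)[OF momentum_has_derivative t] t
  by (auto intro!: continuous_at_imp_continuous_on has_derivative_continuous)

lemma integral_marginal_density:
  fixes g :: "real^'n \<Rightarrow> 'c::euclidean_space"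
  assumes t: "t \<in> {0..T}" and g: "continuous_on UNIV g" "\<And>y. norm (g y) \<le> C * (1 + norm y) ^ k"
  shows "integrable lborel (\<lambda>z. h t (fst z) (snd z) *\<^sub>R g (fst z))"
    and "(LINT z|lborel. h t (fst z) (snd z) *\<^sub>R g (fst z)) = (LINT y|lborel. state_density t y *\<^sub>R g y)"
proof -
  have rapid: "rapidly_decreasing (\<lambda>z. h t (fst z) (snd z) *\<^sub>R g (fst z))"
  proof (rule rapidly_decreasing_dominated[OF rapidly_decreasing_h[OF t], of _ "\<bar>C\<bar>" k])
    fix z :: "(real^'n) \<times> (real^'n)"
    have "norm (g (fst z)) \<le> C * (1 + norm (fst z)) ^ k" by (rule g)
    also have "\<dots> \<le> \<bar>C\<bar> * (1 + norm z) ^ k"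
      using norm_fst_le[of "fst z" "snd z"] by (intro mult_mono power_mono) auto
    finally show "norm (h t (fst z) (snd z) *\<^sub>R g (fst z)) \<le> norm (h t (fst z) (snd z)) * (\<bar>C\<bar> * (1 + norm z) ^ k)"
      by (auto intro!: mult_left_mono)
  qed
  have cont: "continuous_on UNIV (\<lambda>z. h t (fst z) (snd z) *\<^sub>R g (fst z))"
    by (intro continuous_intros continuous_h[OF t] continuous_on_compose2[OF g(1)]) auto
  show "integrable lborel (\<lambda>z. h t (fst z) (snd z) *\<^sub>R g (fst z))"
    by (intro integrable_rapidly_decreasing rapid borel_measurable_continuous_onI cont)
  show "(LINT z|lborel. h t (fst z) (snd z) *\<^sub>R g (fst z)) = (LINT y|lborel. state_density t y *\<^sub>R g y)"
    using integral_marginal[OF rapid cont] integrable_weighted(1)[OF t, of "\<lambda>_. 1::real"] by (simp add: state_density_def)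
qed

text \<open>For an integrand linear in \<lambda>, the inner integral passes through the bounded
  linear map B y and leaves only the momentum.\<close>

lemma integral_marginal_momentum:
  fixes B :: "real^'n \<Rightarrow> real^'n \<Rightarrow> 'c::euclidean_space"
  assumes t: "t \<in> {0..T}" and B: "continuous_on UNIV (\<lambda>z. B (fst z) (snd z))" "\<And>y. bounded_linear (B y)"
    "\<And>y l. norm (B y l) \<le> C * (1 + norm y) ^ k * norm l"
  shows "integrable lborel (\<lambda>z. h t (fst z) (snd z) *\<^sub>R B (fst z) (snd z))"
    and "(LINT z|lborel. h t (fst z) (snd z) *\<^sub>R B (fst z) (snd z)) = (LINT y|lborel. B y (momentum t y))"
proof -
  have rapid: "rapidly_decreasing (\<lambda>z. h t (fst z) (snd z) *\<^sub>R B (fst z) (snd z))"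
  proof (rule rapidly_decreasing_dominated[OF rapidly_decreasing_h[OF t], of _ "\<bar>C\<bar>" "k + 1"])
    fix z :: "(real^'n) \<times> (real^'n)"
    have "norm (B (fst z) (snd z)) \<le> C * (1 + norm (fst z)) ^ k * norm (snd z)" by (rule B)
    also have "\<dots> \<le> \<bar>C\<bar> * (1 + norm z) ^ k * (1 + norm z)"
      using norm_fst_le[of "fst z" "snd z"] norm_snd_le[of "snd z" "fst z"]
      by (intro mult_mono power_mono) auto
    finally show "norm (h t (fst z) (snd z) *\<^sub>R B (fst z) (snd z)) \<le> norm (h t (fst z) (snd z)) * (\<bar>C\<bar> * (1 + norm z) ^ (k + 1))"
      unfolding norm_scaleR real_norm_def by (intro mult_left_mono) (simp_all add: mult_ac)
  qed
  have cont: "continuous_on UNIV (\<lambda>z. h t (fst z) (snd z) *\<^sub>R B (fst z) (snd z))"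
    by (intro continuous_intros continuous_h[OF t] B)
  show "integrable lborel (\<lambda>z. h t (fst z) (snd z) *\<^sub>R B (fst z) (snd z))"
    by (intro integrable_rapidly_decreasing rapid borel_measurable_continuous_onI cont)
  have "(LINT l|lborel. h t y l *\<^sub>R B y l) = B y (momentum t y)" for y
  proof -
    have "(LINT l|lborel. B y (h t y l *\<^sub>R l)) = B y (momentum t y)"
      unfolding momentum_def
      by (rule integral_bounded_linear[OF B(2)]) (rule integrable_weighted(1)[OF t]; simp)
    then show ?thesis by (simp add: linear_cmul[OF bounded_linear.linear[OF B(2)]])
  qed
  with integral_marginal[OF rapid cont]
  show "(LINT z|lborel. h t (fst z) (snd z) *\<^sub>R B (fst z) (snd z)) = (LINT y|lborel. B y (momentum t y))"
    by simp
qed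

end

section \<open>Moments of the kinetic equation\<close>

locale interacting_density = density_path T h h'
  for T and h :: "real \<Rightarrow> real^'n \<Rightarrow> real^'n \<Rightarrow> real" and h' +
  fixes G :: "real^'n \<Rightarrow> real^'n \<Rightarrow> real^'k \<Rightarrow> real^'n"
    and G' :: "(real^'n) \<times> (real^'n) \<times> (real^'k) \<Rightarrow> ((real^'n) \<times> (real^'n) \<times> (real^'k)) \<Rightarrow>\<^sub>L (real^'n)"
    and J :: "real^'k \<Rightarrow> real^'n \<Rightarrow> real"
    and mt :: "real^'n \<Rightarrow> real^'n" and mt' :: "real^'n \<Rightarrow> (real^'n) \<Rightarrow>\<^sub>L (real^'n)"
    and u :: "real \<Rightarrow> real^'k"
  assumes G': "\<And>p. ((\<lambda>(x, y, w). G x y w) has_derivative blinfun_apply (G' p)) (at p)"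
    and cont_G': "continuous_on UNIV G'"
    and growth_G: "\<And>w. \<exists>C k. \<forall>x y. norm (G x y w) + norm (G' (x, y, w)) \<le> C * (1 + norm x + norm y) ^ k"
    and mt': "\<And>x. (mt has_derivative blinfun_apply (mt' x)) (at x)"
    and cont_mt': "continuous_on UNIV mt'"
    and growth_mt: "\<exists>C k. \<forall>x. norm (mt x) \<le> C * (1 + norm x) ^ k"
begin

lemma G_partials:
  shows "((\<lambda>x. G x y w) has_derivative (\<lambda>v. G' (x, y, w) (v, 0, 0))) (at x)"
    and "((\<lambda>y. G x y w) has_derivative (\<lambda>v. G' (x, y, w) (0, v, 0))) (at y)"
    and "((\<lambda>w. G x y w) has_derivative (\<lambda>v. G' (x, y, w) (0, 0, v))) (at w)"
proof -
  have "((\<lambda>x. (x, y, w)) has_derivative (\<lambda>v. (v, 0, 0))) (at x)"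
    "((\<lambda>y. (x, y, w)) has_derivative (\<lambda>v. (0, v, 0))) (at y)"
    "((\<lambda>w. (x, y, w)) has_derivative (\<lambda>v. (0, 0, v))) (at w)"
    by (intro has_derivative_Pair has_derivative_ident has_derivative_const)+
  from this[THEN has_derivative_compose[where g="\<lambda>(x, y, w). G x y w" and g'="blinfun_apply (G' (x, y, w))"]] G'
  show "((\<lambda>x. G x y w) has_derivative (\<lambda>v. G' (x, y, w) (v, 0, 0))) (at x)"
    and "((\<lambda>y. G x y w) has_derivative (\<lambda>v. G' (x, y, w) (0, v, 0))) (at y)"
    and "((\<lambda>w. G x y w) has_derivative (\<lambda>v. G' (x, y, w) (0, 0, v))) (at w)"
    by simp_all
qed

lemma G_jacobians:
  "D1 G x y w *v v = G' (x, y, w) (v, 0, 0)"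
  "D2 G x y w *v v = G' (x, y, w) (0, v, 0)"
  "Du G x y w *v v' = G' (x, y, w) (0, 0, v')"
  unfolding D1_def D2_def Du_def by (rule jacobian_mult, rule G_partials)+

lemma continuous_G: "continuous_on S f \<Longrightarrow> continuous_on S g \<Longrightarrow> continuous_on S (\<lambda>z. G (f z) (g z) w)"
proof -
  assume fg: "continuous_on S f" "continuous_on S g"
  have "continuous_on UNIV (\<lambda>(x, y, w). G x y w)"
    using G' by (intro continuous_at_imp_continuous_on ballI has_derivative_continuous)
  moreover have "continuous_on S (\<lambda>z. (f z, g z, w))"
    by (intro continuous_on_Pair fg continuous_on_const)
  ultimately have "continuous_on S (\<lambda>z. case (f z, g z, w) of (x, y, w) \<Rightarrow> G x y w)"
    by (rule continuous_on_compose2) auto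
  then show ?thesis by simp
qed

lemma continuous_G': "continuous_on S f \<Longrightarrow> continuous_on S g \<Longrightarrow> continuous_on S (\<lambda>z. G' (f z, g z, w) v)"
proof -
  assume fg: "continuous_on S f" "continuous_on S g"
  have "continuous_on S (\<lambda>z. (f z, g z, w))"
    by (intro continuous_on_Pair fg continuous_on_const)
  then have "continuous_on S (\<lambda>z. G' (f z, g z, w))"
    by (rule continuous_on_compose2[OF cont_G']) auto
  then show ?thesis by (intro continuous_intros)
qed

text \<open>The joint bound is the shape required by \<open>parametric_integral\<close>; the
  factored ones, from 1 + |x| + |y| \<le> (1 + |x|)(1 + |y|), serve integrals in one state with the
  other frozen and the double integrals of the control equations.\<close>

lemma growth_G_split:
  obtains C k where "0 \<le> C"
    and "\<And>x y. norm (G x y w) + norm (G' (x, y, w)) \<le> C * (1 + norm x + norm y) ^ k"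
    and "\<And>x y. norm (G x y w) \<le> C * (1 + norm x) ^ k * (1 + norm y) ^ k"
    and "\<And>x y v. norm (G' (x, y, w) v) \<le> C * (1 + norm x) ^ k * (1 + norm y) ^ k * norm v"
proof -
  obtain C k where C: "\<And>x y. norm (G x y w) + norm (G' (x, y, w)) \<le> C * (1 + norm x + norm y) ^ k"
    using growth_G by metis
  have C0: "0 \<le> C"
    using order_trans[OF _ C[of 0 0]] by simp
  have le: "norm (G x y w) + norm (G' (x, y, w)) \<le> C * (1 + norm x) ^ k * (1 + norm y) ^ k" for x y
  proof -
    have "1 + norm x + norm y \<le> (1 + norm x) * (1 + norm y)"
      using mult_nonneg_nonneg[OF norm_ge_zero[of x] norm_ge_zero[of y]] by (simp add: algebra_simps)
    then have "C * (1 + norm x + norm y) ^ k \<le> C * ((1 + norm x) * (1 + norm y)) ^ k"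
      using C0 by (intro mult_left_mono power_mono) auto
    with C[of x y] show ?thesis by (simp add: power_mult_distrib mult.assoc)
  qed
  show thesis
  proof (rule that[OF C0 C])
    show "norm (G x y w) \<le> C * (1 + norm x) ^ k * (1 + norm y) ^ k" for x y
      using le[of x y] norm_ge_zero[of "G' (x, y, w)"] by linarith
    have "norm (G' (x, y, w)) \<le> C * (1 + norm x) ^ k * (1 + norm y) ^ k" for x y
      using le[of x y] norm_ge_zero[of "G x y w"] by linarith
    then show "norm (G' (x, y, w) v) \<le> C * (1 + norm x) ^ k * (1 + norm y) ^ k * norm v" for x y v
      by (intro order_trans[OF norm_blinfun mult_right_mono]) auto
  qed
qed

section \<open>Velocity and force in terms of the two moments\<close>

definition velocity :: "real \<Rightarrow> real^'n \<Rightarrow> real^'n" where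
  "velocity t x = (LINT y|lborel. state_density t y *\<^sub>R G x y (u t))"

definition velocity' :: "real \<Rightarrow> real^'n \<Rightarrow> real^'n \<Rightarrow> real^'n" where
  "velocity' t x v = (LINT y|lborel. state_density t y *\<^sub>R G' (x, y, u t) (v, 0, 0))"

text \<open>Under the identification this is minus the nonlocal term of the adjoint equation, and
  its gradient is the part of the force that comes from the hatted multiplier. Written with the
  momentum, it decays without any growth bound on \<Lambda>.\<close>

definition pairing :: "real \<Rightarrow> real^'n \<Rightarrow> real" where
  "pairing t x = (LINT y|lborel. momentum t y \<bullet> G y x (u t))"

definition pairing' :: "real \<Rightarrow> real^'n \<Rightarrow> real^'n \<Rightarrow> real" where
  "pairing' t x v = (LINT y|lborel. momentum t y \<bullet> G' (y, x, u t) (0, v, 0))"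

lemma velocity:
  assumes t: "t \<in> {0..T}"
  shows "integrable lborel (\<lambda>y. state_density t y *\<^sub>R G x y (u t))"
    and "integrable lborel (\<lambda>y. state_density t y *\<^sub>R G' (x, y, u t) (v, 0, 0))"
    and "(velocity t has_derivative velocity' t x) (at x)"
    and "continuous_on UNIV (\<lambda>x. velocity' t x v)"
proof -
  obtain C k where C: "0 \<le> C" "\<And>x y. norm (G x y (u t)) + norm (G' (x, y, u t)) \<le> C * (1 + norm x + norm y) ^ k"
    by (metis growth_G_split)
  have le: "norm (G x y (u t)) \<le> C * (1 + norm x + norm y) ^ k"
    "norm (G' (x, y, u t)) \<le> C * (1 + norm x + norm y) ^ k" for x y
    using C(2)[of x y] norm_ge_zero[of "G x y (u t)"] norm_ge_zero[of "G' (x, y, u t)"] by linarith+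
  have le': "norm (G' (x, y, u t) (v, 0, 0)) \<le> C * (1 + norm x + norm y) ^ k * norm v" for x y v
    using order_trans[OF norm_blinfun mult_right_mono[OF le(2)], of "(v, 0, 0)" x y] by (simp add: norm_Pair)
  note I = parametric_integral[where H="\<lambda>x y. state_density t y *\<^sub>R G x y (u t)"
      and H'="\<lambda>x y v. state_density t y *\<^sub>R G' (x, y, u t) (v, 0, 0)" and \<phi>="state_density t" and C=C and k=k]
  have 1: "((\<lambda>x. state_density t y *\<^sub>R G x y (u t)) has_derivative (\<lambda>v. state_density t y *\<^sub>R G' (x, y, u t) (v, 0, 0))) (at x)" for x y
    by (rule has_derivative_scaleR_right[OF G_partials(1)])
  have 2: "continuous_on UNIV (\<lambda>y. state_density t y *\<^sub>R G x y (u t))" for x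
    by (intro continuous_on_scaleR continuous_density[OF t] continuous_G continuous_on_const continuous_on_id)
  have "continuous_on UNIV (\<lambda>z. state_density t (snd z) *\<^sub>R G' (fst z, snd z, u t) (v, 0, 0))" for v
    by (intro continuous_on_scaleR continuous_on_compose2[OF continuous_density[OF t]] continuous_G' continuous_on_fst continuous_on_snd continuous_on_id) auto
  then have 3: "continuous_on UNIV (\<lambda>(x, y). state_density t y *\<^sub>R G' (x, y, u t) (v, 0, 0))" for v
    by (simp add: case_prod_unfold)
  have 4: "norm (state_density t y *\<^sub>R G x y (u t)) \<le> \<bar>state_density t y\<bar> * (C * (1 + norm x + norm y) ^ k)" for x y
    using le(1) by (auto intro!: mult_left_mono)
  have 5: "norm (state_density t y *\<^sub>R G' (x, y, u t) (v, 0, 0)) \<le> \<bar>state_density t y\<bar> * (C * (1 + norm x + norm y) ^ k) * norm v" for x y v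
    unfolding norm_scaleR mult.assoc by (intro mult_left_mono le'[unfolded mult.assoc]) auto
  note I = I[OF 1 2 3 rapidly_decreasing_density[OF t] continuous_density[OF t] 4 5]
  show "integrable lborel (\<lambda>y. state_density t y *\<^sub>R G x y (u t))"
    and "integrable lborel (\<lambda>y. state_density t y *\<^sub>R G' (x, y, u t) (v, 0, 0))"
    and "(velocity t has_derivative velocity' t x) (at x)"
    and "continuous_on UNIV (\<lambda>x. velocity' t x v)"
    unfolding velocity_def[abs_def] velocity'_def[abs_def] by (fact I)+
qed

lemma pairing:
  assumes t: "t \<in> {0..T}"
  shows "integrable lborel (\<lambda>y. momentum t y \<bullet> G y x (u t))"
    and "(pairing t has_derivative pairing' t x) (at x)"
    and "continuous_on UNIV (\<lambda>x. pairing' t x v)"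
proof -
  obtain C k where C: "0 \<le> C" "\<And>x y. norm (G x y (u t)) + norm (G' (x, y, u t)) \<le> C * (1 + norm x + norm y) ^ k"
    by (metis growth_G_split)
  have le: "norm (G y x (u t)) \<le> C * (1 + norm x + norm y) ^ k"
    "norm (G' (y, x, u t)) \<le> C * (1 + norm x + norm y) ^ k" for x y
    using C(2)[of y x] norm_ge_zero[of "G y x (u t)"] norm_ge_zero[of "G' (y, x, u t)"]
    unfolding add.assoc add.commute[of "norm y"] by linarith+
  have le': "norm (G' (y, x, u t) (0, v, 0)) \<le> C * (1 + norm x + norm y) ^ k * norm v" for x y v
    using order_trans[OF norm_blinfun mult_right_mono[OF le(2)], of "(0, v, 0)" y x] by (simp add: norm_Pair)
  note I = parametric_integral[where H="\<lambda>x y. momentum t y \<bullet> G y x (u t)"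
      and H'="\<lambda>x y v. momentum t y \<bullet> G' (y, x, u t) (0, v, 0)" and \<phi>="\<lambda>y. norm (momentum t y)" and C=C and k=k]
  have 1: "((\<lambda>x. momentum t y \<bullet> G y x (u t)) has_derivative (\<lambda>v. momentum t y \<bullet> G' (y, x, u t) (0, v, 0))) (at x)" for x y
    by (rule has_derivative_inner_right[OF G_partials(2)])
  have 2: "continuous_on UNIV (\<lambda>y. momentum t y \<bullet> G y x (u t))" for x
    by (intro continuous_on_inner continuous_momentum[OF t] continuous_G continuous_on_const continuous_on_id)
  have "continuous_on UNIV (\<lambda>z. momentum t (snd z) \<bullet> G' (snd z, fst z, u t) (0, v, 0))" for v
    by (intro continuous_on_inner continuous_on_compose2[OF continuous_momentum[OF t]] continuous_G' continuous_on_fst continuous_on_snd continuous_on_id) auto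
  then have 3: "continuous_on UNIV (\<lambda>(x, y). momentum t y \<bullet> G' (y, x, u t) (0, v, 0))" for v
    by (simp add: case_prod_unfold)
  have 4: "norm (momentum t y \<bullet> G y x (u t)) \<le> \<bar>norm (momentum t y)\<bar> * (C * (1 + norm x + norm y) ^ k)" for x y
    unfolding real_norm_def abs_norm_cancel
    by (rule order_trans[OF Cauchy_Schwarz_ineq2]) (intro mult_left_mono le norm_ge_zero)
  have 5: "norm (momentum t y \<bullet> G' (y, x, u t) (0, v, 0)) \<le> \<bar>norm (momentum t y)\<bar> * (C * (1 + norm x + norm y) ^ k) * norm v" for x y v
    unfolding real_norm_def abs_norm_cancel mult.assoc
    by (rule order_trans[OF Cauchy_Schwarz_ineq2]) (intro mult_left_mono le'[unfolded mult.assoc] norm_ge_zero)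
  have 6: "rapidly_decreasing (\<lambda>y. norm (momentum t y))"
    by (rule rapidly_decreasing_le[OF rapidly_decreasing_momentum[OF t]]) simp
  note I = I[OF 1 2 3 6 continuous_on_norm[OF continuous_momentum[OF t]] 4 5]
  show "integrable lborel (\<lambda>y. momentum t y \<bullet> G y x (u t))"
    by (fact I)
  show "(pairing t has_derivative pairing' t x) (at x)"
    and "continuous_on UNIV (\<lambda>x. pairing' t x v)"
    unfolding pairing_def[abs_def] pairing'_def[abs_def] by (fact I)+
qed

lemma om_velocity_eq:
  assumes t: "t \<in> {0..T}"
  shows "om_velocity G (u t) (h t) = velocity t"
proof
  fix x
  obtain C k where C: "\<And>x y. norm (G x y (u t)) \<le> C * (1 + norm x) ^ k * (1 + norm y) ^ k"
    by (metis growth_G_split)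
  show "om_velocity G (u t) (h t) x = velocity t x"
    unfolding om_velocity_def velocity_def
    by (rule integral_marginal_density(2)[OF t _ C]) (intro continuous_G continuous_on_const continuous_on_id)
qed

lemma om_mean_eq:
  assumes t: "t \<in> {0..T}"
  shows "om_mean mt (h t) = mo_mean mt (state_density t)"
proof -
  obtain C k where C: "\<And>x. norm (mt x) \<le> C * (1 + norm x) ^ k"
    using growth_mt by blast
  have "continuous_on UNIV mt"
    using mt' by (intro continuous_at_imp_continuous_on ballI has_derivative_continuous)
  from integral_marginal_density(2)[OF t this C] show ?thesis
    unfolding om_mean_def mo_mean_def .
qed

definition force :: "real \<Rightarrow> real^'n \<Rightarrow> real^'n \<Rightarrow> real^'n" where
  "force t x l = om_force G J mt (u t) (h t) x l"

text \<open>The force at \<lambda> = 0 as a linear form in e. The same form is the gradient of those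
  terms of the adjoint left-hand side that are not the transport of \<Lambda>.\<close>

definition source :: "real \<Rightarrow> real^'n \<Rightarrow> real^'n \<Rightarrow> real" where
  "source t x e = pairing' t x e + grad (\<lambda>m. J (u t) m) (om_mean mt (h t)) \<bullet> mt' x e"

text \<open>Pairing with e replaces each transposed Jacobian by a directional derivative of G along
  e. The first-argument part is linear in l and averages to the derivative of the velocity; the
  second-argument part is linear in the hatted multiplier and averages to
  \<open>pairing'\<close>.\<close>

lemma inner_force:
  assumes t: "t \<in> {0..T}"
  shows "force t x l \<bullet> e = l \<bullet> velocity' t x e + source t x e"
proof -
  let ?F = "\<lambda>z. h t (fst z) (snd z) *\<^sub>R
    (transpose (D1 G x (fst z) (u t)) *v l + transpose (D2 G (fst z) x (u t)) *v snd z)"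
  obtain C k where C: "0 \<le> C"
    "\<And>x y v. norm (G' (x, y, u t) v) \<le> C * (1 + norm x) ^ k * (1 + norm y) ^ k * norm v"
    by (metis growth_G_split)
  have F: "?F z \<bullet> e = h t (fst z) (snd z) *\<^sub>R (l \<bullet> G' (x, fst z, u t) (e, 0, 0)) +
      h t (fst z) (snd z) *\<^sub>R (snd z \<bullet> G' (fst z, x, u t) (0, e, 0))" for z e
    by (simp only: inner_scaleR_left inner_add_left inner_transpose_mult G_jacobians real_scaleR_def distrib_left)
  have g: "norm (l \<bullet> G' (x, y, u t) (e, 0, 0)) \<le> (norm l * (C * (1 + norm x) ^ k) * norm e) * (1 + norm y) ^ k" for y e
    using order_trans[OF Cauchy_Schwarz_ineq2 mult_left_mono[OF C(2)], of l x y "(e, 0, 0)"]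
    by (simp add: norm_Pair mult_ac)
  have gc: "continuous_on UNIV (\<lambda>y. l \<bullet> G' (x, y, u t) (e, 0, 0))" for e
    by (intro continuous_on_inner continuous_G' continuous_on_const continuous_on_id)
  have B: "norm (\<mu> \<bullet> G' (y, x, u t) (0, e, 0)) \<le> (C * (1 + norm x) ^ k * norm e) * (1 + norm y) ^ k * norm \<mu>" for y \<mu> e
    using order_trans[OF Cauchy_Schwarz_ineq2 mult_left_mono[OF C(2)], of \<mu> y x "(0, e, 0)"]
    by (simp add: norm_Pair mult_ac)
  have Bc: "continuous_on UNIV (\<lambda>z::(real^'n) \<times> (real^'n). snd z \<bullet> G' (fst z, x, u t) (0, e, 0))" for e
    by (intro continuous_on_inner continuous_G' continuous_on_const continuous_on_fst continuous_on_snd continuous_on_id)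
  note I1 = integral_marginal_density[OF t gc g]
  note I2 = integral_marginal_momentum[where B="\<lambda>y \<mu>. \<mu> \<bullet> G' (y, x, u t) (0, e, 0)" for e, OF t Bc bounded_linear_inner_left B]
  have "integrable lborel ?F"
    by (rule integrable_vecI, unfold F, intro Bochner_Integration.integrable_add I1(1) I2(1))
  then have "(LINT z|lborel. ?F z) \<bullet> e = (LINT z|lborel. ?F z \<bullet> e)"
    by (rule integral_inner_left[symmetric])
  also have "\<dots> = (LINT y|lborel. state_density t y *\<^sub>R (l \<bullet> G' (x, y, u t) (e, 0, 0))) + pairing' t x e"
    unfolding F pairing'_def by (simp only: Bochner_Integration.integral_add[OF I1(1) I2(1)] I1(2) I2(2))
  also have "(LINT y|lborel. state_density t y *\<^sub>R (l \<bullet> G' (x, y, u t) (e, 0, 0))) = l \<bullet> velocity' t x e"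
    unfolding velocity'_def using integral_inner_right[OF velocity(2)[OF t], of l x e] by simp
  finally show ?thesis
    unfolding force_def om_force_def source_def
    by (simp only: inner_add_left inner_transpose_mult jacobian_mult[OF mt'] add.assoc)
qed

end

section \<open>Integrating the kinetic equation in \<lambda>\<close>

context interacting_density
begin

definition divergence :: "real \<Rightarrow> real^'n \<Rightarrow> real" where
  "divergence t x = divg (velocity t) x"

lemma force_affine:
  assumes "t \<in> {0..T}"
  shows "force t x l = (\<chi> i. l \<bullet> velocity' t x (axis i 1)) + force t x 0"
proof -
  have "force t x l $ i = l \<bullet> velocity' t x (axis i 1) + source t x (axis i 1)" for l i
    using inner_force[OF assms, of x l "axis i 1"] by (simp add: inner_axis)
  then show ?thesis by (simp add: vec_eq_iff)
qed

text \<open>With x frozen, the force is affine in l, so the flux and its derivative in l still decay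
  rapidly and \<open>integral_divg\<close> applies. The same affinity lets the integrated flux be
  expressed by the two moments alone.\<close>

lemma force_flux:
  fixes x :: "real^'n"
  assumes t: "t \<in> {0..T}"
  defines "\<Phi> \<equiv> \<lambda>l. h t x l *\<^sub>R force t x l"
  shows "integrable lborel (divg \<Phi>)" "(LINT l|lborel. divg \<Phi> l) = 0"
    and "integrable lborel (\<lambda>l. divg \<Phi> l *\<^sub>R l)" "(LINT l|lborel. divg \<Phi> l *\<^sub>R l) = - (LINT l|lborel. \<Phi> l)"
    and "(LINT l|lborel. \<Phi> l) \<bullet> e = momentum t x \<bullet> velocity' t x e + state_density t x * source t x e"
proof -
  define A where "A = (\<lambda>l. (\<chi> i. l \<bullet> velocity' t x (axis i 1)) :: real^'n)"
  define b where "b = force t x 0"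
  have F: "force t x = (\<lambda>l. A l + b)"
    unfolding A_def b_def by (rule ext) (rule force_affine[OF t])
  have lin: "linear A"
    by (rule linearI) (simp_all add: A_def vec_eq_iff inner_add_left)
  then have blin: "bounded_linear A" by (simp add: linear_conv_bounded_linear)
  obtain K where K: "0 \<le> K" "\<And>l. norm (A l) \<le> norm l * K"
    using bounded_linear.nonneg_bounded[OF blin] by blast
  have contA: "continuous_on S A" for S
    by (rule linear_continuous_on[OF blin])
  have Fle: "norm (force t x l) \<le> (K + norm b) * (1 + norm l) ^ 1" for l
  proof -
    have "norm (force t x l) \<le> norm l * K + norm b"
      unfolding F by (rule order_trans[OF norm_triangle_ineq]) (use K in simp)
    also have "\<dots> \<le> (K + norm b) * (1 + norm l) ^ 1"
      using K mult_nonneg_nonneg[OF norm_ge_zero[of b] norm_ge_zero[of l]] by (simp add: algebra_simps)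
    finally show ?thesis .
  qed
  define \<Phi>' where "\<Phi>' = (\<lambda>l v. h t x l *\<^sub>R A v + h' (t, x, l) (0, 0, v) *\<^sub>R force t x l)"
  \<comment> \<open>The factor adds the bounds for the two terms of the product rule: K for the
    derivative of the force, K + |b| for the force itself.\<close>
  define \<beta> where "\<beta> = (\<lambda>l. (\<bar>h t x l\<bar> + norm (h' (t, x, l))) * ((K + (K + norm b)) * (1 + norm l)))"
  have der: "(\<Phi> has_derivative \<Phi>' l) (at l)" for l
  proof -
    have "((\<lambda>l. A l + b) has_derivative A) (at l)"
      using bounded_linear_imp_has_derivative[OF blin] by (auto intro!: derivative_eq_intros)
    from has_derivative_scaleR[OF h_partials(3)[OF t] this] show ?thesis
      unfolding \<Phi>_def \<Phi>'_def F .
  qed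
  have cont: "continuous_on UNIV (\<lambda>l. \<Phi>' l v)" for v
    unfolding \<Phi>'_def F by (intro continuous_intros continuous_section_h[OF t] contA)
  have rapid: "rapidly_decreasing \<Phi>"
    by (rule rapidly_decreasing_dominated[OF rapidly_decreasing_section_h[OF t, of x], of _ "K + norm b" 1])
      (use Fle in \<open>auto simp: \<Phi>_def intro!: mult_left_mono\<close>)
  have rapid\<beta>: "rapidly_decreasing \<beta>"
    by (rule rapidly_decreasing_dominated[OF rapidly_decreasing_section_jet[OF t, of x], of _ "K + (K + norm b)" 1])
      (use K in \<open>simp add: \<beta>_def abs_mult\<close>)
  have le: "norm (\<Phi>' l v) \<le> \<beta> l * norm v" for l v
  proof -
    let ?j = "\<bar>h t x l\<bar> + norm (h' (t, x, l))"
    have "norm (A v) \<le> K * 1 * norm v" using K(2)[of v] by (simp add: mult.commute)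
    also have "\<dots> \<le> K * (1 + norm l) * norm v" using K(1) by (intro mult_right_mono mult_left_mono) auto
    finally have 1: "norm (h t x l *\<^sub>R A v) \<le> ?j * (K * (1 + norm l) * norm v)"
      unfolding norm_scaleR by (intro mult_mono) auto
    have "norm (h' (t, x, l) (0, 0, v)) \<le> ?j * norm v"
      using norm_h'_le[of t x l "(0, 0, v)"] by (simp add: norm_Pair)
    then have 2: "norm (h' (t, x, l) (0, 0, v) *\<^sub>R force t x l) \<le> ?j * norm v * ((K + norm b) * (1 + norm l) ^ 1)"
      unfolding norm_scaleR real_norm_def by (intro mult_mono Fle) auto
    have "norm (\<Phi>' l v) \<le> ?j * (K * (1 + norm l) * norm v) + ?j * norm v * ((K + norm b) * (1 + norm l) ^ 1)"
      unfolding \<Phi>'_def by (rule order_trans[OF norm_triangle_ineq add_mono[OF 1 2]])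
    also have "\<dots> = \<beta> l * norm v"
      unfolding \<beta>_def by (simp only: power_one_right distrib_left distrib_right mult_ac)
    finally show ?thesis .
  qed
  note I = integral_divg[OF der cont rapid rapid\<beta> le]
  show "integrable lborel (divg \<Phi>)" "(LINT l|lborel. divg \<Phi> l) = 0"
    and "integrable lborel (\<lambda>l. divg \<Phi> l *\<^sub>R l)" "(LINT l|lborel. divg \<Phi> l *\<^sub>R l) = - (LINT l|lborel. \<Phi> l)"
    by (fact I)+
  have int1: "integrable lborel (h t x)"
    using integrable_weighted(1)[OF t, of "\<lambda>_. 1::real" x] by simp
  have int2: "integrable lborel (\<lambda>l. h t x l *\<^sub>R l)"
    by (rule integrable_weighted(1)[OF t]) auto
  have "integrable lborel \<Phi>"
    using der by (intro integrable_rapidly_decreasing rapid borel_measurable_continuous_onI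
        continuous_at_imp_continuous_on ballI has_derivative_continuous)
  then have "(LINT l|lborel. \<Phi> l) \<bullet> e = (LINT l|lborel. \<Phi> l \<bullet> e)"
    by (rule integral_inner_left[symmetric])
  also have "\<dots> = (LINT l|lborel. (h t x l *\<^sub>R l) \<bullet> velocity' t x e + h t x l * source t x e)"
    unfolding \<Phi>_def by (simp add: inner_force[OF t] distrib_left)
  also have "\<dots> = (LINT l|lborel. (h t x l *\<^sub>R l) \<bullet> velocity' t x e) + (LINT l|lborel. h t x l * source t x e)"
    using int1 int2 by (intro Bochner_Integration.integral_add integrable_inner_left integrable_mult_left) auto
  also have "\<dots> = momentum t x \<bullet> velocity' t x e + state_density t x * source t x e"
    unfolding momentum_def state_density_def using int1 integral_inner_left[OF int2] by simp
  finally show "(LINT l|lborel. \<Phi> l) \<bullet> e = momentum t x \<bullet> velocity' t x e + state_density t x * source t x e" .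
qed

text \<open>The velocity does not depend on l. After the product rule in x, linearity of
  \<open>h'\<close> joins time derivative and transport into one derivative along (1, velocity, 0),
  which can then be integrated in l.\<close>

lemma om_kinetic_eq:
  assumes t: "t \<in> {0..T}"
  shows "om_kinetic T G J mt u h t x l = h' (t, x, l) (1, velocity t x, 0) + h t x l * divergence t x
    - divg (\<lambda>l. h t x l *\<^sub>R force t x l) l"
proof -
  have "h' (t, x, l) (1, velocity t x, 0) = h' (t, x, l) (1, 0, 0) + h' (t, x, l) (0, velocity t x, 0)"
    by (simp add: blinfun.add_right[symmetric])
  then show ?thesis
    using divg_scaleR[OF h_partials(2)[OF t] velocity(3)[OF t], of l x]
    by (simp add: om_kinetic_def h_partials(1)[OF t] om_velocity_eq[OF t] divergence_def force_def)
qed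

lemma kinetic_moment_0:
  assumes t: "t \<in> {0..T}"
  shows "(LINT l|lborel. om_kinetic T G J mt u h t x l) = state_density' t x (1, velocity t x) + state_density t x * divergence t x"
proof -
  note W = integrable_weighted[OF t, of "\<lambda>_. 1::real" x, simplified]
  show ?thesis
    unfolding om_kinetic_eq[OF t] state_density'_def state_density_def
    using W force_flux[OF t, of x] by simp
qed

lemma kinetic_moment_1:
  assumes t: "t \<in> {0..T}"
  shows "(LINT l|lborel. om_kinetic T G J mt u h t x l *\<^sub>R l) \<bullet> e =
    momentum' t x (1, velocity t x) \<bullet> e + divergence t x * (momentum t x \<bullet> e)
    + momentum t x \<bullet> velocity' t x e + state_density t x * source t x e"
proof -
  have W: "integrable lborel (\<lambda>l. h t x l *\<^sub>R l)" "integrable lborel (\<lambda>l. h' (t, x, l) v *\<^sub>R l)" for v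
    by (rule integrable_weighted[OF t]; simp)+
  note int = W(2)[of "(1, velocity t x, 0)"] integrable_scaleR_right[OF W(1), of "divergence t x"] force_flux(3)[OF t, of x]
  have "om_kinetic T G J mt u h t x l *\<^sub>R l = h' (t, x, l) (1, velocity t x, 0) *\<^sub>R l
      + divergence t x *\<^sub>R (h t x l *\<^sub>R l) - divg (\<lambda>l. h t x l *\<^sub>R force t x l) l *\<^sub>R l" for l
    unfolding om_kinetic_eq[OF t] by (simp add: scaleR_add_left scaleR_diff_left)
  then have "(LINT l|lborel. om_kinetic T G J mt u h t x l *\<^sub>R l) =
      momentum' t x (1, velocity t x) + divergence t x *\<^sub>R momentum t x + (LINT l|lborel. h t x l *\<^sub>R force t x l)"
    by (simp only: Bochner_Integration.integral_diff[OF Bochner_Integration.integrable_add[OF int(1,2)] int(3)]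
        Bochner_Integration.integral_add[OF int(1,2)] integral_scaleR_right force_flux(4)[OF t, of x]
        momentum'_def momentum_def fst_conv snd_conv diff_minus_eq_add)
  then show ?thesis
    using force_flux(5)[OF t, of x e] by (simp add: inner_add_left)
qed

section \<open>The control integral\<close>

text \<open>The integrand, paired with e, does not contain the hatted multiplier and is linear in
  the other one. Fubini therefore reduces one copy of the density to the state density and the other
  to the momentum. The second claim gives Fubini for the control integral of the mean-field
  problem.\<close>

lemma om_control_integral:
  assumes t: "t \<in> {0..T}"
  defines "g \<equiv> \<lambda>x y e. G' (x, y, u t) (0, 0, e)"
  shows "(LINT p|lborel. (case p of ((x, l), (y, \<mu>)) \<Rightarrow>
      (h t x l * h t y \<mu>) *\<^sub>R (transpose (Du G x y (u t)) *v l))) \<bullet> e =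
    (LINT x|lborel. LINT y|lborel. state_density t y * (momentum t x \<bullet> g x y e))"
    and "integrable lborel (\<lambda>(x, y). state_density t y * (momentum t x \<bullet> g x y e))"
proof -
  obtain C k where C: "0 \<le> C"
    "\<And>x y v. norm (G' (x, y, u t) v) \<le> C * (1 + norm x) ^ k * (1 + norm y) ^ k * norm v"
    by (metis growth_G_split)
  have g: "norm (l \<bullet> g x y e) \<le> norm l * (C * (1 + norm x) ^ k * (1 + norm y) ^ k * norm e)" for x y l e
    using order_trans[OF Cauchy_Schwarz_ineq2 mult_left_mono[OF C(2)], of l x y "(0, 0, e)"]
    by (simp add: norm_Pair g_def)
  have cont_g: "continuous_on S (\<lambda>z. g (a z) (b z) e)" if "continuous_on S a" "continuous_on S b"
    for S :: "'z::topological_space set" and a b e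
    unfolding g_def by (rule continuous_G'[OF that])
  define F where "F = (\<lambda>p. (h t (fst (fst p)) (snd (fst p)) * h t (fst (snd p)) (snd (snd p))) *\<^sub>R
      (transpose (Du G (fst (fst p)) (fst (snd p)) (u t)) *v snd (fst p)))"
  have F: "F p \<bullet> e = (h t (fst (fst p)) (snd (fst p)) * h t (fst (snd p)) (snd (snd p))) *
      (snd (fst p) \<bullet> g (fst (fst p)) (fst (snd p)) e)" for p e
    unfolding F_def g_def by (simp only: inner_scaleR_left inner_transpose_mult G_jacobians)
  have int: "integrable lborel (\<lambda>p. F p \<bullet> e)" for e
  proof (intro integrable_rapidly_decreasing borel_measurable_continuous_onI)
    have c: "continuous_on UNIV (\<lambda>p::((real^'n) \<times> (real^'n)) \<times> ((real^'n) \<times> (real^'n)). h t (fst (fst p)) (snd (fst p)))"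
      "continuous_on UNIV (\<lambda>p::((real^'n) \<times> (real^'n)) \<times> ((real^'n) \<times> (real^'n)). h t (fst (snd p)) (snd (snd p)))"
      by (rule continuous_on_compose2[OF continuous_h[OF t]]; auto intro!: continuous_on_fst continuous_on_snd continuous_on_id)+
    show "continuous_on UNIV (\<lambda>p. F p \<bullet> e)"
      unfolding F
      by (intro continuous_on_mult continuous_on_inner c cont_g continuous_on_fst continuous_on_snd continuous_on_id)
    \<comment> \<open>Of the exponent 1 + k + k, one power bounds the multiplier l and k powers each
      bound the growth of G in its two states.\<close>
    show "rapidly_decreasing (\<lambda>p. F p \<bullet> e)"
    proof (rule rapidly_decreasing_dominated[OF rapidly_decreasing_prod[OF rapidly_decreasing_h[OF t] rapidly_decreasing_h[OF t]],
          of _ "C * norm e" "1 + k + k"])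
      fix p :: "((real^'n) \<times> (real^'n)) \<times> ((real^'n) \<times> (real^'n))"
      have n: "norm (fst (fst p)) \<le> norm p" "norm (snd (fst p)) \<le> norm p" "norm (fst (snd p)) \<le> norm p"
        using norm_fst_le[of "fst p" "snd p"] norm_snd_le[of "snd p" "fst p"]
          norm_fst_le[of "fst (fst p)" "snd (fst p)"] norm_snd_le[of "snd (fst p)" "fst (fst p)"]
          norm_fst_le[of "fst (snd p)" "snd (snd p)"] by simp_all
      have "norm (snd (fst p) \<bullet> g (fst (fst p)) (fst (snd p)) e)
          \<le> norm (snd (fst p)) * (C * (1 + norm (fst (fst p))) ^ k * (1 + norm (fst (snd p))) ^ k * norm e)"
        by (rule g)
      also have "\<dots> \<le> (1 + norm p) * (C * (1 + norm p) ^ k * (1 + norm p) ^ k * norm e)"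
        using n C(1) by (intro mult_mono mult_right_mono mult_left_mono power_mono mult_nonneg_nonneg zero_le_power) auto
      also have "\<dots> = C * norm e * (1 + norm p) ^ (1 + k + k)"
        by (simp only: power_add power_one_right mult_ac)
      finally show "norm (F p \<bullet> e) \<le> norm (h t (fst (fst p)) (snd (fst p)) * h t (fst (snd p)) (snd (snd p))) * (C * norm e * (1 + norm p) ^ (1 + k + k))"
        unfolding F norm_mult[of "_ * _" "_ \<bullet> _"] by (intro mult_left_mono) auto
    qed
  qed
  have Fub: "integrable lborel (\<lambda>x. LINT y|lborel. f (x, y))" "(LINT p|lborel. f p) = (LINT x|lborel. LINT y|lborel. f (x, y))"
    if "integrable lborel f" for f :: "'x::euclidean_space \<times> 'y::euclidean_space \<Rightarrow> real"
    using lborel_pair.integrable_fst'[of f] lborel_pair.integral_fst'[of f] that by (simp_all add: lborel_prod)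
  have "continuous_on UNIV (\<lambda>p. state_density t (snd p) * (momentum t (fst p) \<bullet> g (fst p) (snd p) e))"
    by (intro continuous_on_mult continuous_on_inner cont_g continuous_on_compose2[OF continuous_density[OF t]]
        continuous_on_compose2[OF continuous_momentum[OF t]] continuous_on_fst continuous_on_snd continuous_on_id) auto
  moreover have "rapidly_decreasing (\<lambda>p. state_density t (snd p) * (momentum t (fst p) \<bullet> g (fst p) (snd p) e))"
  proof (rule rapidly_decreasing_dominated[OF rapidly_decreasing_prod[OF rapidly_decreasing_le[OF rapidly_decreasing_momentum[OF t], of "\<lambda>x. norm (momentum t x)"]
          rapidly_decreasing_density[OF t]], of _ "C * norm e" "k + k"])
    fix p :: "(real^'n) \<times> (real^'n)"
    have "norm (momentum t (fst p) \<bullet> g (fst p) (snd p) e)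
        \<le> norm (momentum t (fst p)) * (C * (1 + norm (fst p)) ^ k * (1 + norm (snd p)) ^ k * norm e)"
      by (rule g)
    also have "\<dots> \<le> norm (momentum t (fst p)) * (C * (1 + norm p) ^ k * (1 + norm p) ^ k * norm e)"
      using norm_fst_le[of "fst p" "snd p"] norm_snd_le[of "snd p" "fst p"] C(1)
      by (intro mult_mono mult_right_mono mult_left_mono power_mono mult_nonneg_nonneg zero_le_power) auto
    finally have "norm (state_density t (snd p) * (momentum t (fst p) \<bullet> g (fst p) (snd p) e))
        \<le> norm (state_density t (snd p)) * (norm (momentum t (fst p)) * (C * (1 + norm p) ^ k * (1 + norm p) ^ k * norm e))"
      unfolding norm_mult by (intro mult_left_mono) auto
    then show "norm (state_density t (snd p) * (momentum t (fst p) \<bullet> g (fst p) (snd p) e))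
        \<le> norm (norm (momentum t (fst p)) * state_density t (snd p)) * (C * norm e * (1 + norm p) ^ (k + k))"
      by (simp add: norm_mult abs_mult power_add mult_ac)
  qed simp
  ultimately show "integrable lborel (\<lambda>(x, y). state_density t y * (momentum t x \<bullet> g x y e))"
    by (simp add: case_prod_unfold integrable_rapidly_decreasing borel_measurable_continuous_onI)
  \<comment> \<open>The control derivative in direction e, averaged over the hatted state.
    Integrating out the hatted pair first leaves an integrand that is linear in l with coefficient
    w.\<close>
  define w where "w = (\<lambda>x. LINT y|lborel. state_density t y *\<^sub>R g x y e)"
  have gW: "norm (g x y e) \<le> (C * (1 + norm x) ^ k * norm e) * (1 + norm y) ^ k" for x y
    using C(2)[of x y "(0, 0, e)"] by (simp add: g_def norm_Pair mult_ac)
  have intw: "integrable lborel (\<lambda>y. state_density t y *\<^sub>R g x y e)" for x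
  proof (intro integrable_rapidly_decreasing borel_measurable_continuous_onI)
    show "rapidly_decreasing (\<lambda>y. state_density t y *\<^sub>R g x y e)"
      by (rule rapidly_decreasing_dominated[OF rapidly_decreasing_density[OF t], of _ "C * (1 + norm x) ^ k * norm e" k])
        (use gW in \<open>auto intro!: mult_left_mono\<close>)
    show "continuous_on UNIV (\<lambda>y. state_density t y *\<^sub>R g x y e)"
      by (intro continuous_on_scaleR continuous_density[OF t] cont_g continuous_on_const continuous_on_id)
  qed
  have inner: "(LINT q|lborel. F (z, q) \<bullet> e) = h t (fst z) (snd z) * (snd z \<bullet> w (fst z))" for z
  proof -
    have w: "(LINT q|lborel. h t (fst q) (snd q) *\<^sub>R g (fst z) (fst q) e) = w (fst z)"
      and int: "integrable lborel (\<lambda>q. h t (fst q) (snd q) *\<^sub>R g (fst z) (fst q) e)"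
      unfolding w_def
      by (rule integral_marginal_density[OF t _ gW], intro cont_g continuous_on_const continuous_on_id)+
    have "snd z \<bullet> w (fst z) = (LINT q|lborel. snd z \<bullet> (h t (fst q) (snd q) *\<^sub>R g (fst z) (fst q) e))"
      unfolding w[symmetric] by (rule integral_inner_right[symmetric, OF int])
    then show ?thesis
      unfolding F by (simp add: mult.assoc)
  qed
  have "(LINT p|lborel. F p) \<bullet> e = (LINT p|lborel. F p \<bullet> e)"
    by (rule integral_inner_left[symmetric]) (rule integrable_vecI, rule int)
  also have "\<dots> = (LINT z|lborel. LINT q|lborel. F (z, q) \<bullet> e)"
    by (rule Fub(2)[OF int])
  also have "\<dots> = (LINT z|lborel. h t (fst z) (snd z) * (snd z \<bullet> w (fst z)))"
    by (simp only: inner)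
  also have "\<dots> = (LINT x|lborel. LINT l|lborel. h t x l * (l \<bullet> w x))"
    using Fub(2)[OF Fub(1)[OF int[of e], unfolded inner]] by simp
  also have "\<dots> = (LINT x|lborel. momentum t x \<bullet> w x)"
  proof (rule Bochner_Integration.integral_cong[OF refl])
    fix x
    have "integrable lborel (\<lambda>l. h t x l *\<^sub>R l)"
      by (rule integrable_weighted(1)[OF t]) auto
    from integral_inner_left[OF this, of "w x"]
    show "(LINT l|lborel. h t x l * (l \<bullet> w x)) = momentum t x \<bullet> w x"
      by (simp add: momentum_def)
  qed
  also have "\<dots> = (LINT x|lborel. LINT y|lborel. state_density t y * (momentum t x \<bullet> g x y e))"
    unfolding w_def by (simp add: integral_inner_right[OF intw, symmetric])
  finally show "(LINT p|lborel. (case p of ((x, l), (y, \<mu>)) \<Rightarrow>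
      (h t x l * h t y \<mu>) *\<^sub>R (transpose (Du G x y (u t)) *v l))) \<bullet> e =
    (LINT x|lborel. LINT y|lborel. state_density t y * (momentum t x \<bullet> g x y e))"
    unfolding F_def by (simp only: case_prod_unfold)
qed

end

section \<open>The adjoint variable\<close>

text \<open>\<rho> is kept apart from \<open>state_density\<close>: the two agree at slab times
  only, since the factorisation says nothing about other times. The momentum equation is required at
  every x, on the support or not, so it may be differentiated.\<close>

locale adjoint_pair = interacting_density T h h' G G' J mt mt' u
  for T and h :: "real \<Rightarrow> real^'n \<Rightarrow> real^'n \<Rightarrow> real" and h'
    and G :: "real^'n \<Rightarrow> real^'n \<Rightarrow> real^'k \<Rightarrow> real^'n" and G' J mt mt' u +
  fixes \<rho> :: "real \<Rightarrow> real^'n \<Rightarrow> real"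
    and \<Lambda> :: "real \<Rightarrow> real^'n \<Rightarrow> real"
    and \<Lambda>' :: "real \<times> (real^'n) \<Rightarrow> (real \<times> (real^'n)) \<Rightarrow>\<^sub>L real"
    and \<Lambda>'' :: "real \<times> (real^'n) \<Rightarrow> (real \<times> (real^'n)) \<Rightarrow>\<^sub>L (real \<times> (real^'n)) \<Rightarrow>\<^sub>L real"
  assumes \<Lambda>': "\<And>p. p \<in> {0..T} \<times> UNIV \<Longrightarrow>
      ((\<lambda>(t, x). \<Lambda> t x) has_derivative blinfun_apply (\<Lambda>' p)) (at p within {0..T} \<times> UNIV)"
    and \<Lambda>'': "\<And>p. p \<in> {0..T} \<times> UNIV \<Longrightarrow>
      (\<Lambda>' has_derivative blinfun_apply (\<Lambda>'' p)) (at p within {0..T} \<times> UNIV)"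
    and cont_\<Lambda>'': "continuous_on ({0..T} \<times> UNIV) \<Lambda>''"
    and \<rho>: "\<And>t x. t \<in> {0..T} \<Longrightarrow> state_density t x = \<rho> t x"
    and momentum_eq: "\<And>t x. t \<in> {0..T} \<Longrightarrow> momentum t x = - (\<rho> t x *\<^sub>R grad (\<Lambda> t) x)"
begin

lemma state_density_eq: "t \<in> {0..T} \<Longrightarrow> state_density t = \<rho> t"
  by (rule ext) (rule \<rho>)

lemma \<Lambda>_partials:
  assumes t: "t \<in> {0..T}"
  shows "vector_derivative (\<lambda>s. \<Lambda> s x) (at t within {0..T}) = \<Lambda>' (t, x) (1, 0)"
    and "grad (\<Lambda> t) x \<bullet> v = \<Lambda>' (t, x) (0, v)"
    and "((\<lambda>x. \<Lambda>' (t, x)) has_derivative (\<lambda>v. \<Lambda>'' (t, x) (0, v))) (at x)"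
proof -
  have p: "(t, x) \<in> {0..T} \<times> UNIV" using t by simp
  show "vector_derivative (\<lambda>s. \<Lambda> s x) (at t within {0..T}) = \<Lambda>' (t, x) (1, 0)"
    using slab_partial_derivatives(1)[OF \<Lambda>'[OF p] t] t T
    by (intro vector_derivative_within_closed_interval) simp_all
  show "grad (\<Lambda> t) x \<bullet> v = \<Lambda>' (t, x) (0, v)"
    using slab_partial_derivatives(2)[OF \<Lambda>'[OF p] t] by (intro grad_inner) simp
  show "((\<lambda>x. \<Lambda>' (t, x)) has_derivative (\<lambda>v. \<Lambda>'' (t, x) (0, v))) (at x)"
    by (rule slab_partial_derivatives(2)[OF \<Lambda>''[OF p] t])
qed

text \<open>At t < T the corner spanned by (1, v) and (0, e) stays in the slab for time steps up to
  T - t. At t = T it has to point backwards in time, so (1, v) is replaced by its negative; the sign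
  cancels by bilinearity.\<close>

lemma \<Lambda>''_symmetric:
  assumes t: "t \<in> {0..T}"
  shows "\<Lambda>'' (t, x) (1, v) (0, e) = \<Lambda>'' (t, x) (0, e) (1, v)"
proof (cases "t < T")
  case True
  show ?thesis
    by (rule second_derivative_symmetric_within[OF \<Lambda>' \<Lambda>'' cont_\<Lambda>'', of "T - t"]) (use t True in auto)
next
  case False
  have "\<Lambda>'' (t, x) (- (1, v)) (0, e) = \<Lambda>'' (t, x) (0, e) (- (1, v))"
    by (rule second_derivative_symmetric_within[OF \<Lambda>' \<Lambda>'' cont_\<Lambda>'', of T]) (use t T False in auto)
  then show ?thesis by (simp only: blinfun.minus_left blinfun.minus_right neg_equal_iff_equal)
qed

text \<open>Both sides are derivatives within the slab of the same function, the momentum paired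
  with e: on the left by differentiation under the integral, on the right by the product rule for
  -\<rho> times the derivative of \<Lambda> along e.\<close>

lemma momentum'_inner:
  assumes t: "t \<in> {0..T}"
  shows "momentum' t x v \<bullet> e = - (state_density t x * \<Lambda>'' (t, x) v (0, e) + state_density' t x v * \<Lambda>' (t, x) (0, e))"
proof -
  let ?S = "{0..T} \<times> (UNIV :: (real^'n) set)"
  have p: "(t, x) \<in> ?S" using t by simp
  have lhs: "((\<lambda>p. (case p of (t, x) \<Rightarrow> momentum t x) \<bullet> e) has_derivative (\<lambda>v. momentum' t x v \<bullet> e)) (at (t, x) within ?S)"
    by (rule has_derivative_inner_left[OF momentum_has_derivative[OF t]])
  have eq: "(case p of (t, x) \<Rightarrow> momentum t x) \<bullet> e = - ((case p of (t, x) \<Rightarrow> state_density t x) * \<Lambda>' p (0, e))"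
    if "p \<in> ?S" for p
    using that by (auto simp: momentum_eq \<rho> \<Lambda>_partials(2))
  have "((\<lambda>p. \<Lambda>' p (0, e)) has_derivative (\<lambda>v. \<Lambda>'' (t, x) v (0, e))) (at (t, x) within ?S)"
    using bounded_linear.has_derivative[OF blinfun.bounded_linear_left \<Lambda>''[OF p]] .
  from has_derivative_minus[OF has_derivative_mult[OF state_density_has_derivative[OF t] this]]
  have "((\<lambda>p. - ((case p of (t, x) \<Rightarrow> state_density t x) * \<Lambda>' p (0, e))) has_derivative
      (\<lambda>v. - (state_density t x * \<Lambda>'' (t, x) v (0, e) + state_density' t x v * \<Lambda>' (t, x) (0, e)))) (at (t, x) within ?S)"
    by simp
  note has_derivative_transform[OF p eq this]
  with lhs have "((\<lambda>p. (case p of (t, x) \<Rightarrow> momentum t x) \<bullet> e) has_derivative (\<lambda>v. momentum' t x v \<bullet> e)) (at (t, x) within ?S)"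
    "((\<lambda>p. (case p of (t, x) \<Rightarrow> momentum t x) \<bullet> e) has_derivative
      (\<lambda>v. - (state_density t x * \<Lambda>'' (t, x) v (0, e) + state_density' t x v * \<Lambda>' (t, x) (0, e)))) (at (t, x) within ?S)" .
  then have "(\<lambda>v. momentum' t x v \<bullet> e) = (\<lambda>v. - (state_density t x * \<Lambda>'' (t, x) v (0, e) + state_density' t x v * \<Lambda>' (t, x) (0, e)))"
  proof (rule frechet_derivative_unique_within)
    \<comment> \<open>Derivatives within a set are unique only if the set can be approached along
      every basis direction. At t = T the time direction is approached with a negative step, before
      T with a positive one, of size at most half the available room.\<close>
    fix i :: "real \<times> (real^'n)" and \<epsilon> :: real assume i: "i \<in> Basis" and \<epsilon>: "0 < \<epsilon>"
    have fi: "fst i = 0 \<or> fst i = 1" using i by (auto simp: Basis_prod_def)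
    show "\<exists>d. 0 < \<bar>d\<bar> \<and> \<bar>d\<bar> < \<epsilon> \<and> (t, x) + d *\<^sub>R i \<in> ?S"
    proof (cases "t < T")
      case True
      then show ?thesis
        using t \<epsilon> fi by (intro exI[of _ "min \<epsilon> (T - t) / 2"]) (auto simp: mem_Times_iff min_def field_simps)
    next
      case False
      then show ?thesis
        using t T \<epsilon> fi by (intro exI[of _ "- (min \<epsilon> T / 2)"]) (auto simp: mem_Times_iff min_def field_simps)
    qed
  qed
  then show ?thesis by (rule fun_cong)
qed

section \<open>The mean-field equations in terms of the moments\<close>

lemma mo_state_eq:
  assumes t: "t \<in> {0..T}"
  shows "mo_state T G u \<rho> t x = state_density' t x (1, velocity t x) + state_density t x * divergence t x"
proof -
  note p = slab_partial_derivatives[OF state_density_has_derivative[OF t] t, simplified]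
  have "((\<lambda>s. \<rho> s x) has_vector_derivative state_density' t x (1, 0)) (at t within {0..T})"
    by (rule has_vector_derivative_transform[OF t _ p(1)]) (simp add: \<rho>)
  then have 1: "vector_derivative (\<lambda>s. \<rho> s x) (at t within {0..T}) = state_density' t x (1, 0)"
    using T t by (intro vector_derivative_within_closed_interval) auto
  have 2: "mo_velocity G (u t) (\<rho> t) = velocity t"
    unfolding mo_velocity_def velocity_def state_density_eq[OF t] ..
  have "state_density' t x ((1, 0) + (0, velocity t x)) = state_density' t x (1, 0) + state_density' t x (0, velocity t x)"
    by (rule linear_add[OF has_derivative_linear[OF state_density_has_derivative[OF t]]])
  then show ?thesis
    unfolding mo_state_def 1 2
    using divg_scaleR[OF p(2) velocity(3)[OF t]] by (simp add: state_density_eq[OF t] divergence_def)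
qed

text \<open>Product rule for the material derivative of \<Lambda>, evaluated at (1, velocity t x):
  the second-derivative term moves the base point, the other one moves the velocity.\<close>

definition adjoint' :: "real \<Rightarrow> real^'n \<Rightarrow> real^'n \<Rightarrow> real" where
  "adjoint' t x e = source t x e - (\<Lambda>'' (t, x) (0, e) (1, velocity t x) + \<Lambda>' (t, x) (0, velocity' t x e))"

text \<open>The time derivative and the local transport term merge into the material derivative of
  \<Lambda>. In the nonlocal term, \<rho> \<nabla>\<Lambda> at y is replaced by -m, which gives
  convergence and makes the result differentiable in x although \<nabla>\<Lambda> may grow
  arbitrarily.\<close>

lemma mo_adjoint_eq:
  assumes t: "t \<in> {0..T}"
  shows "mo_adjoint T G J mt u \<rho> \<Lambda> t x =
    grad (\<lambda>m. J (u t) m) (om_mean mt (h t)) \<bullet> mt x - \<Lambda>' (t, x) (1, velocity t x) + pairing t x"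
proof -
  have "(G x y (u t) \<bullet> grad (\<Lambda> t) x + G y x (u t) \<bullet> grad (\<Lambda> t) y) * \<rho> t y =
      (state_density t y *\<^sub>R G x y (u t)) \<bullet> grad (\<Lambda> t) x - momentum t y \<bullet> G y x (u t)" for y
    by (simp add: momentum_eq[OF t] state_density_eq[OF t] inner_commute algebra_simps)
  then have "(LINT y|lborel. (G x y (u t) \<bullet> grad (\<Lambda> t) x + G y x (u t) \<bullet> grad (\<Lambda> t) y) * \<rho> t y) =
      (LINT y|lborel. (state_density t y *\<^sub>R G x y (u t)) \<bullet> grad (\<Lambda> t) x) - pairing t x"
    unfolding pairing_def
    by (simp only: Bochner_Integration.integral_diff[OF integrable_inner_left[OF velocity(1)[OF t]] pairing(1)[OF t]])
  also have "(LINT y|lborel. (state_density t y *\<^sub>R G x y (u t)) \<bullet> grad (\<Lambda> t) x) = velocity t x \<bullet> grad (\<Lambda> t) x"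
    unfolding velocity_def using integral_inner_left[OF velocity(1)[OF t]] by blast
  also have "\<dots> = \<Lambda>' (t, x) (0, velocity t x)"
    by (simp add: inner_commute \<Lambda>_partials(2)[OF t])
  finally show ?thesis
    using blinfun.add_right[of "\<Lambda>' (t, x)" "(1, 0)" "(0, velocity t x)"]
    by (simp add: mo_adjoint_def \<Lambda>_partials(1)[OF t] om_mean_eq[OF t] state_density_eq[OF t])
qed

lemma mo_adjoint_has_derivative:
  assumes t: "t \<in> {0..T}"
  shows "(mo_adjoint T G J mt u \<rho> \<Lambda> t has_derivative adjoint' t x) (at x)"
proof -
  have "((\<lambda>x. (1, velocity t x)) has_derivative (\<lambda>v. (0, velocity' t x v))) (at x)"
    by (intro has_derivative_Pair has_derivative_const velocity(3)[OF t])
  from blinfun.FDERIV[OF \<Lambda>_partials(3)[OF t] this]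
  have 1: "((\<lambda>x. \<Lambda>' (t, x) (1, velocity t x)) has_derivative
      (\<lambda>v. \<Lambda>' (t, x) (0, velocity' t x v) + \<Lambda>'' (t, x) (0, v) (1, velocity t x))) (at x)" .
  show ?thesis
    unfolding mo_adjoint_eq[OF t, abs_def] adjoint'_def[abs_def] source_def
    by (rule has_derivative_eq_rhs,
        rule has_derivative_add[OF has_derivative_diff[OF has_derivative_inner_right[OF mt'] 1] pairing(2)[OF t]])
      (simp add: fun_eq_iff)
qed

lemma continuous_adjoint':
  assumes t: "t \<in> {0..T}"
  shows "continuous_on UNIV (\<lambda>x. adjoint' t x e)"
proof -
  have p: "continuous_on UNIV (\<lambda>x::real^'n. (t, x))"
    by (intro continuous_on_Pair continuous_on_const continuous_on_id)
  have "continuous_on UNIV (\<lambda>x. \<Lambda>'' (t, x))"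
    by (rule continuous_on_compose2[OF cont_\<Lambda>'' p]) (use t in auto)
  moreover have "continuous_on UNIV (\<lambda>x. \<Lambda>' (t, x))"
    using \<Lambda>_partials(3)[OF t] by (intro continuous_at_imp_continuous_on ballI has_derivative_continuous)
  moreover have "continuous_on UNIV (velocity t)"
    using velocity(3)[OF t] by (intro continuous_at_imp_continuous_on ballI has_derivative_continuous)
  ultimately show ?thesis
    unfolding adjoint'_def source_def
    by (intro continuous_on_diff continuous_on_add continuous_on_inner blinfun.continuous_on continuous_on_Pair
        continuous_on_const cont_mt' pairing(3)[OF t] velocity(4)[OF t])
qed

lemma mo_adjoint_stationary_iff:
  assumes t: "t \<in> {0..T}"
  shows "(mo_adjoint T G J mt u \<rho> \<Lambda> t has_derivative (\<lambda>_. 0)) (at x) \<longleftrightarrow> (\<forall>e. adjoint' t x e = 0)"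
proof
  assume "(mo_adjoint T G J mt u \<rho> \<Lambda> t has_derivative (\<lambda>_. 0)) (at x)"
  from has_derivative_unique[OF mo_adjoint_has_derivative[OF t] this] show "\<forall>e. adjoint' t x e = 0"
    by (simp add: fun_eq_iff)
next
  assume "\<forall>e. adjoint' t x e = 0"
  then have "adjoint' t x = (\<lambda>_. 0)" by auto
  with mo_adjoint_has_derivative[OF t, of x] show "(mo_adjoint T G J mt u \<rho> \<Lambda> t has_derivative (\<lambda>_. 0)) (at x)"
    by simp
qed

section \<open>Equivalence of the two systems\<close>

lemma kinetic_moment_0_eq:
  "t \<in> {0..T} \<Longrightarrow> (LINT l|lborel. om_kinetic T G J mt u h t x l) = mo_state T G u \<rho> t x"
  by (simp add: kinetic_moment_0 mo_state_eq)

text \<open>Differentiating the product -\<rho> \<nabla>\<Lambda> gives two terms. The one with the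
  second derivative of \<Lambda>, after exchanging its arguments, joins the force terms to \<rho>
  times \<open>adjoint'\<close>; the one with the derivative of \<rho> joins the divergence term to
  the state equation times \<nabla>\<Lambda>.\<close>

lemma kinetic_moment_1_eq:
  assumes t: "t \<in> {0..T}"
  shows "(LINT l|lborel. om_kinetic T G J mt u h t x l *\<^sub>R l) \<bullet> e =
    \<rho> t x * adjoint' t x e - mo_state T G u \<rho> t x * \<Lambda>' (t, x) (0, e)"
  unfolding kinetic_moment_1[OF t] momentum'_inner[OF t] mo_state_eq[OF t] adjoint'_def \<Lambda>''_symmetric[OF t]
  by (simp add: momentum_eq[OF t] state_density_eq[OF t] \<Lambda>_partials(2)[OF t] algebra_simps)

lemma kinetic_moments_iff:
  assumes t: "t \<in> {0..T}"
  shows "(\<forall>x. (LINT l|lborel. om_kinetic T G J mt u h t x l) = 0 \<and>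
      (LINT l|lborel. om_kinetic T G J mt u h t x l *\<^sub>R l) = 0) \<longleftrightarrow>
    (\<forall>x. mo_state T G u \<rho> t x = 0) \<and>
    (\<forall>x\<in>supp (\<rho> t). (mo_adjoint T G J mt u \<rho> \<Lambda> t has_derivative (\<lambda>_. 0)) (at x))"
proof -
  have 1: "(LINT l|lborel. om_kinetic T G J mt u h t x l *\<^sub>R l) = 0 \<longleftrightarrow> (\<forall>e. \<rho> t x * adjoint' t x e = 0)"
    if "mo_state T G u \<rho> t x = 0" for x
    using kinetic_moment_1_eq[OF t, of x] that vector_eq_rdot[of "LINT l|lborel. om_kinetic T G J mt u h t x l *\<^sub>R l" 0]
    by simp
  \<comment> \<open>The support argument is made for each fixed e, where \<open>adjoint'\<close> is
    a continuous scalar function of x; the quantifier over e is exchanged afterwards.\<close>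
  have 2: "(\<forall>x\<in>supp (\<rho> t). adjoint' t x e = 0) \<longleftrightarrow> (\<forall>x. \<rho> t x * adjoint' t x e = 0)" for e
    using vanishing_on_supp_iff[OF continuous_adjoint'[OF t]] by simp
  have 3: "(\<forall>x\<in>supp (\<rho> t). \<forall>e. adjoint' t x e = 0) \<longleftrightarrow> (\<forall>x e. \<rho> t x * adjoint' t x e = 0)"
    using 2 by blast
  show ?thesis
    unfolding kinetic_moment_0_eq[OF t] mo_adjoint_stationary_iff[OF t] 3 using 1 by blast
qed

text \<open>The support argument once more, at t = T: the terminal momentum is -\<rho>
  \<nabla>\<Lambda>, and \<nabla>\<Lambda> is continuous in x.\<close>

lemma terminal_iff: "(\<forall>x. (LINT l|lborel. h T x l *\<^sub>R l) = 0) \<longleftrightarrow> (\<forall>x\<in>supp (\<rho> T). grad (\<Lambda> T) x = 0)"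
proof -
  have t: "T \<in> {0..T}" using T by simp
  have "continuous_on UNIV (\<lambda>x. \<Lambda>' (T, x))"
    using \<Lambda>_partials(3)[OF t] by (intro continuous_at_imp_continuous_on ballI has_derivative_continuous)
  then have "continuous_on UNIV (\<lambda>x. \<chi> i. \<Lambda>' (T, x) (0, axis i 1))"
    by (intro continuous_intros)
  moreover have "grad (\<Lambda> T) x = (\<chi> i. \<Lambda>' (T, x) (0, axis i 1))" for x
    by (simp add: vec_eq_iff \<Lambda>_partials(2)[OF t, symmetric] inner_axis)
  ultimately have "continuous_on UNIV (grad (\<Lambda> T))" by (simp cong: continuous_on_cong)
  from vanishing_on_supp_iff[OF this, of "\<rho> T"] show ?thesis
    using momentum_eq[OF t] by (simp add: momentum_def)
qed

text \<open>Holds without either evolution equation: the means coincide, so the terms from J agree,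
  and the sign in m = -\<rho> \<nabla>\<Lambda> is compensated by the opposite signs of the two
  integrals.\<close>

lemma control_eq:
  assumes t: "t \<in> {0..T}"
  shows "om_control \<alpha> G J mt (u t) (h t) = mo_control \<alpha> G J mt (u t) (\<rho> t) (\<Lambda> t)"
proof -
  let ?F = "\<lambda>p. (\<rho> t (fst p) * \<rho> t (snd p)) *\<^sub>R (transpose (Du G (fst p) (snd p) (u t)) *v grad (\<Lambda> t) (fst p))"
  let ?g = "\<lambda>x y e. state_density t y * (momentum t x \<bullet> G' (x, y, u t) (0, 0, e))"
  have F: "?F p \<bullet> e = - ?g (fst p) (snd p) e" for p e
    unfolding inner_scaleR_left inner_transpose_mult G_jacobians momentum_eq[OF t] state_density_eq[OF t]
    by (simp add: mult_ac)
  note int = om_control_integral(2)[OF t]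
  have intF: "integrable lborel ?F"
    by (rule integrable_vecI, unfold F) (use int in \<open>simp add: case_prod_unfold\<close>)
  have inner_F: "(LINT p|lborel. ?F p) \<bullet> e = - (LINT x|lborel. LINT y|lborel. ?g x y e)" for e
  proof -
    have "(LINT p|lborel. ?F p) \<bullet> e = (LINT p|lborel. ?F p \<bullet> e)"
      by (rule integral_inner_left[symmetric, OF intF])
    also have "\<dots> = - (LINT p|lborel. ?g (fst p) (snd p) e)"
      unfolding F by (rule Bochner_Integration.integral_minus)
    also have "(LINT p|lborel. ?g (fst p) (snd p) e) = (LINT x|lborel. LINT y|lborel. ?g x y e)"
      using lborel_pair.integral_fst'[of "\<lambda>(x, y). ?g x y e"] int[of e]
      by (simp add: lborel_prod case_prod_unfold)
    finally show ?thesis .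
  qed
  have "(LINT p|lborel. (case p of ((x, l), (y, \<mu>)) \<Rightarrow>
      (h t x l * h t y \<mu>) *\<^sub>R (transpose (Du G x y (u t)) *v l))) = - (LINT p|lborel. ?F p)"
    by (rule vector_eq_rdot[THEN iffD1], rule allI)
      (simp only: om_control_integral(1)[OF t] inner_minus_left inner_F minus_minus)
  then show ?thesis
    unfolding om_control_def mo_control_def om_mean_eq[OF t] state_density_eq[OF t] by (simp add: case_prod_unfold)
qed

lemma mo_system_iff: "mo_system T \<alpha> G J mt h0 u \<rho> \<Lambda> \<longleftrightarrow> om_moment_system T \<alpha> G J mt h0 u h"
proof -
  have "(LINT l|lborel. h 0 x l) = \<rho> 0 x" for x
    using \<rho>[of 0 x] T by (simp add: state_density_def)
  then show ?thesis
    unfolding mo_system_def om_moment_system_def om_boundary_def terminal_iff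
    using kinetic_moments_iff control_eq by auto
qed

end

text \<open>\<nabla>\<Lambda> carries only the mean of the conditional density, so the direction
  from \<Lambda> back to the phase-space density is expressed by the moment system, not by the
  kinetic equation at every \<lambda>.\<close>

theorem lemma2p1:
  fixes T \<alpha> :: real
    and G :: "real^'n \<Rightarrow> real^'n \<Rightarrow> real^'k \<Rightarrow> real^'n"
    and J :: "real^'k \<Rightarrow> real^'n \<Rightarrow> real"
    and mt :: "real^'n \<Rightarrow> real^'n"
    and u :: "real \<Rightarrow> real^'k"
    and h0 :: "real^'n \<Rightarrow> real"
    and hOM :: "real \<Rightarrow> real^'n \<Rightarrow> real^'n \<Rightarrow> real"
    and hMO :: "real \<Rightarrow> real^'n \<Rightarrow> real"
    and h2 :: "real \<Rightarrow> real^'n \<Rightarrow> real^'n \<Rightarrow> real"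
    and \<Lambda> :: "real \<Rightarrow> real^'n \<Rightarrow> real"
  assumes "0 < T" and "0 < \<alpha>"
    and "regular_interaction G"
    and "(\<lambda>(w, m). J w m) differentiable_on UNIV"
    and "regular_observable mt"
    and "regular_density T hOM"
    and "C2_on (\<lambda>(t, x). \<Lambda> t x) ({0..T} \<times> UNIV)"
    and factorization: "\<And>t x l. t \<in> {0..T} \<Longrightarrow> hOM t x l = hMO t x * h2 t x l"
    and conditional: "\<And>t x. t \<in> {0..T} \<Longrightarrow> x \<in> supp (hMO t) \<Longrightarrow> (LINT l|lborel. h2 t x l) = 1"
    and identification: "\<And>t x. t \<in> {0..T} \<Longrightarrow> x \<in> supp (hMO t) \<Longrightarrow>
            grad (\<Lambda> t) x = - (LINT l|lborel. h2 t x l *\<^sub>R l)"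
  shows "(om_system T \<alpha> G J mt h0 u hOM \<longrightarrow> mo_system T \<alpha> G J mt h0 u hMO \<Lambda>) \<and>
         (mo_system T \<alpha> G J mt h0 u hMO \<Lambda> \<longleftrightarrow> om_moment_system T \<alpha> G J mt h0 u hOM)"
proof -
  obtain h' where h': "\<And>p. p \<in> {0..T} \<times> UNIV \<Longrightarrow>
      ((\<lambda>(t, x, l). hOM t x l) has_derivative blinfun_apply (h' p)) (at p within {0..T} \<times> UNIV)"
    "continuous_on ({0..T} \<times> UNIV) h'"
    "\<And>k. \<exists>C. \<forall>t\<in>{0..T}. \<forall>x l. (1 + norm x + norm l) ^ k * (\<bar>hOM t x l\<bar> + norm (h' (t, x, l))) \<le> C"
    using \<open>regular_density T hOM\<close> unfolding regular_density_def by blast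
  obtain G' where G': "\<And>p. ((\<lambda>(x, y, w). G x y w) has_derivative blinfun_apply (G' p)) (at p)"
    "continuous_on UNIV G'"
    "\<And>w. \<exists>C k. \<forall>x y. norm (G x y w) + norm (G' (x, y, w)) \<le> C * (1 + norm x + norm y) ^ k"
    using \<open>regular_interaction G\<close> unfolding regular_interaction_def by blast
  obtain mt' where mt': "\<And>x. (mt has_derivative blinfun_apply (mt' x)) (at x)" "continuous_on UNIV mt'"
    "\<exists>C k. \<forall>x. norm (mt x) \<le> C * (1 + norm x) ^ k"
    using \<open>regular_observable mt\<close> unfolding regular_observable_def C1_on_def by auto
  obtain \<Lambda>' \<Lambda>'' where \<Lambda>: "\<And>p. p \<in> {0..T} \<times> UNIV \<Longrightarrow>
      ((\<lambda>(t, x). \<Lambda> t x) has_derivative blinfun_apply (\<Lambda>' p)) (at p within {0..T} \<times> UNIV)"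
    "\<And>p. p \<in> {0..T} \<times> UNIV \<Longrightarrow> (\<Lambda>' has_derivative blinfun_apply (\<Lambda>'' p)) (at p within {0..T} \<times> UNIV)"
    "continuous_on ({0..T} \<times> UNIV) \<Lambda>''"
    using \<open>C2_on (\<lambda>(t, x). \<Lambda> t x) ({0..T} \<times> UNIV)\<close> unfolding C2_on_def C1_on_def by blast
  interpret interacting_density T hOM h' G G' J mt mt' u
    by unfold_locales (fact \<open>0 < T\<close> h' G' mt')+
  \<comment> \<open>On the support the constant factor hMO t x leaves the integral, for any
    integrand, and the normalisation of h2 remains. Off the support hMO t x = 0 makes both sides
    vanish, whatever h2 is there. The momentum identity below splits in the same way.\<close>
  have "state_density t x = hMO t x" if t: "t \<in> {0..T}" for t x
    using conditional[OF t, of x] not_in_supp[of x "hMO t"]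
    by (cases "x \<in> supp (hMO t)") (simp_all add: state_density_def factorization[OF t])
  moreover have "momentum t x = - (hMO t x *\<^sub>R grad (\<Lambda> t) x)" if t: "t \<in> {0..T}" for t x
    using identification[OF t, of x] not_in_supp[of x "hMO t"]
    by (cases "x \<in> supp (hMO t)")
      (simp_all add: momentum_def factorization[OF t] scaleR_scaleR[symmetric] del: scaleR_scaleR)
  ultimately interpret adjoint_pair T hOM h' G G' J mt mt' u hMO \<Lambda> \<Lambda>' \<Lambda>''
    by unfold_locales (use \<Lambda> in auto)
  \<comment> \<open>A kinetic expression that vanishes at every \<lambda> has vanishing moments; the
    boundary and control parts of the two systems are identical.\<close>
  have "om_system T \<alpha> G J mt h0 u hOM \<Longrightarrow> om_moment_system T \<alpha> G J mt h0 u hOM"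
    by (simp add: om_system_def om_moment_system_def)
  with mo_system_iff show ?thesis by blast
qed

end
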